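(* Let $\rho$ be a positive weight function on $\mathbb{R}_+=(0,\infty)$ and $I\subseteq\mathbb{R}$ an open interval such that $\int_0^\infty x^ie^{tx}\rho(x)\,dx<\infty$ for all integers $i\ge 0$ and $t\in I$. For $i,j\ge0$ and $t\in I$ put $$\mu_{i,j}(t)=\iint_{\mathbb{R}_+^2}x^iy^j\frac{x-y}{x+y}e^{t(x+y)}\rho(x)\rho(y)\,dx\,dy,\qquad \beta_i(t)=\int_{\mathbb{R}_+}x^ie^{tx}\rho(x)\,dx,$$ let $\tau_{2n}(t)=Pf(0,1,\dots,2n-1)\ne0$, $\tau_{2n+1}(t)=Pf(d_0,0,1,\dots,2n)\neq 0$, and define the monic polynomials in $z$ $$P_{2n}(z;t)=\frac{1}{\tau_{2n}}Pf(0,1,\dots,2n,z),\qquad P_{2n+1}(z;t)=\frac{1}{\tau_{2n+1}}Pf(d_0,0,1,\dots,2n+1,z),$$ with Pfaffian entries $Pf(i,j)=\mu_{i,j}(t)$, $Pf(d_0,i)=\beta_i(t)$, $Pf(i,z)=z^i$, $Pf(d_0,z)=0$. Then for all $n\ge 0$ the polynomials satisfy the four-term recurrence relation $$z(P_n+u_nP_{n-1})=P_{n+1}+(b_{n+1}-b_n+u_n)P_n-u_n(b_{n+1}-b_n+u_{n+1})P_{n-1}-u_n^2u_{n-1}P_{n-2},$$ where $u_n=\dfrac{\tau_{n+1}\tau_{n-1}}{\tau_n^2}$ and $b_n=\dfrac{d}{dt}\log\tau_n$.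
   Context: Hirota's Pfaffian notation: given symbols $a_1,\dots,a_{2N}$ and prescribed entries $Pf(a_i,a_j)=-Pf(a_j,a_i)$, $Pf(a_1,\dots,a_{2N})$ denotes the Pfaffian of the $2N\times 2N$ skew-symmetric matrix with $(i,j)$ entry $Pf(a_i,a_j)$; the empty Pfaffian is $1$. Conventions: $\tau_0=1$, $\tau_{-1}=0$ (so $u_0=b_0=0$), and any term containing $u_0$, $u_{-1}$, $P_{-1}$ or $P_{-2}$ is $0$. $\frac{d}{dt}\log\tau_n$ means $\tau_n'/\tau_n$. *)

theory Defs
  imports "HOL-Analysis.Analysis" "HOL-Computational_Algebra.Polynomial"
begin

text \<open>
  The Pfaffian of the skew-symmetric matrix \<open>(A i j)\<close>, \<open>i, j < 2 * N\<close>, as a signed sum over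
  perfect matchings.  A matching \<open>{i\<^sub>0, j\<^sub>0}, \<dots>\<close> of \<open>{0, \<dots>, 2 * N - 1}\<close> is represented by the unique
  permutation \<open>(i\<^sub>0, j\<^sub>0, i\<^sub>1, j\<^sub>1, \<dots>)\<close> with \<open>i\<^sub>k < j\<^sub>k\<close> and \<open>i\<^sub>0 < i\<^sub>1 < \<dots>\<close>; this normalisation replaces
  the factor \<open>1 / (2 ^ N * fact N)\<close> in the sum over all permutations, so that the definition
  makes sense over a polynomial ring.
\<close>

definition matching_perms :: "nat \<Rightarrow> (nat \<Rightarrow> nat) set" where
  "matching_perms N = {\<sigma>. \<sigma> permutes {..<2 * N} \<and>
     (\<forall>i<N. \<sigma> (2 * i) < \<sigma> (2 * i + 1)) \<and>
     (\<forall>i j. i < j \<and> j < N \<longrightarrow> \<sigma> (2 * i) < \<sigma> (2 * j))}"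

definition pfaffian :: "nat \<Rightarrow> (nat \<Rightarrow> nat \<Rightarrow> 'a::comm_ring_1) \<Rightarrow> 'a" where
  "pfaffian N A =
     (\<Sum>\<sigma>\<in>matching_perms N. of_int (sign \<sigma>) * (\<Prod>i<N. A (\<sigma> (2 * i)) (\<sigma> (2 * i + 1))))"

text \<open>
  Hirota's \<open>Pf(a\<^sub>1, \<dots>, a\<^sub>2\<^sub>N)\<close> for a list of symbols and a skew-symmetric table of entries.
  It is only meant for lists of even length.
\<close>

definition Pf :: "('s \<Rightarrow> 's \<Rightarrow> 'a::comm_ring_1) \<Rightarrow> 's list \<Rightarrow> 'a" where
  "Pf entry as = pfaffian (length as div 2) (\<lambda>i j. entry (as ! i) (as ! j))"

definition moment :: "(real \<Rightarrow> real) \<Rightarrow> real \<Rightarrow> nat \<Rightarrow> nat \<Rightarrow> real" where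
  "moment \<rho> t i j =
     (LINT p:{0<..} \<times> {0<..}|lebesgue.
        fst p ^ i * snd p ^ j * ((fst p - snd p) / (fst p + snd p)) *
        exp (t * (fst p + snd p)) * \<rho> (fst p) * \<rho> (snd p))"

definition single_moment :: "(real \<Rightarrow> real) \<Rightarrow> real \<Rightarrow> nat \<Rightarrow> real" where
  "single_moment \<rho> t i = (LINT x:{0<..}|lebesgue. x ^ i * exp (t * x) * \<rho> x)"

text \<open>
  The symbols \<open>d\<^sub>0, 0, 1, 2, \<dots>\<close> have real entries.  Adjoining the symbol \<open>z\<close> gives entries in
  \<open>\<real>[z]\<close>, so that the Pfaffians containing \<open>z\<close> are polynomials.
\<close>

datatype symbol = D0 | Idx nat

datatype zsymbol = Sym symbol | Z

fun entry :: "(real \<Rightarrow> real) \<Rightarrow> real \<Rightarrow> symbol \<Rightarrow> symbol \<Rightarrow> real" where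
  "entry \<rho> t (Idx i) (Idx j) = moment \<rho> t i j"
| "entry \<rho> t D0 (Idx i) = single_moment \<rho> t i"
| "entry \<rho> t (Idx i) D0 = - single_moment \<rho> t i"
| "entry \<rho> t D0 D0 = 0"

fun zentry :: "(real \<Rightarrow> real) \<Rightarrow> real \<Rightarrow> zsymbol \<Rightarrow> zsymbol \<Rightarrow> real poly" where
  "zentry \<rho> t (Sym a) (Sym b) = [:entry \<rho> t a b:]"
| "zentry \<rho> t (Sym (Idx i)) Z = monom 1 i"
| "zentry \<rho> t Z (Sym (Idx i)) = - monom 1 i"
| "zentry \<rho> t (Sym D0) Z = 0"
| "zentry \<rho> t Z (Sym D0) = 0"
| "zentry \<rho> t Z Z = 0"

text \<open>
  The index \<open>k\<close> is an integer so that \<open>\<tau>\<^sub>-\<^sub>1\<close>, \<open>P\<^sub>-\<^sub>1\<close> and \<open>P\<^sub>-\<^sub>2\<close> are available and equal to \<open>0\<close>;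
  \<open>\<tau>\<^sub>0\<close> is the empty Pfaffian.  Consequently \<open>u\<^sub>0 = 0\<close>, \<open>b\<^sub>0 = 0\<close>, and also \<open>u\<^sub>-\<^sub>1 = 0\<close> because of
  \<open>x / 0 = 0\<close>.
\<close>

definition tau :: "(real \<Rightarrow> real) \<Rightarrow> real \<Rightarrow> int \<Rightarrow> real" where
  "tau \<rho> t k =
     (if k < 0 then 0
      else if even k then Pf (entry \<rho> t) (map Idx [0..<nat k])
      else Pf (entry \<rho> t) (D0 # map Idx [0..<nat k]))"

definition Ppoly :: "(real \<Rightarrow> real) \<Rightarrow> real \<Rightarrow> int \<Rightarrow> real poly" where
  "Ppoly \<rho> t k =
     (if k < 0 then 0
      else if even k then
        smult (1 / tau \<rho> t k) (Pf (zentry \<rho> t) (map (Sym \<circ> Idx) [0..<nat k + 1] @ [Z]))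
      else
        smult (1 / tau \<rho> t k)
          (Pf (zentry \<rho> t) (Sym D0 # map (Sym \<circ> Idx) [0..<nat k + 1] @ [Z])))"

definition ucoef :: "(real \<Rightarrow> real) \<Rightarrow> real \<Rightarrow> int \<Rightarrow> real" where
  "ucoef \<rho> t k = tau \<rho> t (k + 1) * tau \<rho> t (k - 1) / (tau \<rho> t k)\<^sup>2"

text \<open>
  The logarithmic derivative is taken as \<open>\<tau>' / \<tau>\<close>, since \<open>\<tau>\<close> may be negative.
\<close>

definition bcoef :: "(real \<Rightarrow> real) \<Rightarrow> real \<Rightarrow> int \<Rightarrow> real" where
  "bcoef \<rho> t k = deriv (\<lambda>s. tau \<rho> s k) t / tau \<rho> t k"

end

theory Submission
  imports Defs
begin

text \<open>
  Write \<open>\<langle>p, q\<rangle>\<close> for the skew form with matrix \<open>(\<mu>\<^sub>i\<^sub>j)\<close>, \<open>\<beta>\<close> for the functional \<open>z\<^sup>i \<mapsto> \<beta>\<^sub>i\<close> and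
  \<open>h\<^sub>k = \<tau>\<^sub>k\<^sub>+\<^sub>1 / \<tau>\<^sub>k\<close>.  Replacing the symbol \<open>z\<close> by \<open>j\<close> or \<open>d\<^sub>0\<close> in the Pfaffian of \<open>P\<^sub>k\<close> shows that
  \<open>\<langle>P\<^sub>k, z\<^sup>j\<rangle> = c\<^sub>k \<beta>\<^sub>j\<close> for \<open>j \<le> k\<close>, where \<open>c\<^sub>k\<close> is \<open>0\<close> or \<open>- h\<^sub>k\<close>, and that \<open>\<beta> P\<^sub>k\<close> is \<open>h\<^sub>k\<close> or \<open>0\<close>, for
  \<open>k\<close> even or odd.  Since the kernel is \<open>(x - y) / (x + y)\<close>, multiplication by \<open>z\<close> satisfies
  \<open>\<langle>z p, q\<rangle> + \<langle>p, z q\<rangle> = \<beta>(z p) \<beta> q - \<beta> p \<beta>(z q)\<close>.  Hence the difference \<open>r\<close> of the two sides of the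
  recurrence satisfies \<open>\<langle>r, f\<rangle> = \<beta> r \<beta> f\<close> for all \<open>f\<close> of degree below \<open>n\<close>; as \<open>r\<close> itself has degree
  below \<open>n\<close>, nondegeneracy forces \<open>r = 0\<close>.  The numbers \<open>b\<^sub>k\<close> enter through the coefficient of
  \<open>z\<^sup>k\<^sup>-\<^sup>1\<close> in \<open>P\<^sub>k\<close>, which is \<open>- \<tau>\<^sub>k' / \<tau>\<^sub>k\<close>: as \<open>\<mu>\<^sub>i\<^sub>j' = \<mu>\<^sub>i\<^sub>+\<^sub>1\<^sub>,\<^sub>j + \<mu>\<^sub>i\<^sub>,\<^sub>j\<^sub>+\<^sub>1\<close> and \<open>\<beta>\<^sub>i' = \<beta>\<^sub>i\<^sub>+\<^sub>1\<close>,
  differentiating \<open>\<tau>\<^sub>k\<close> raises its last index by one.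
\<close>

subsection \<open>Expansion of Pfaffians\<close>

lemma pfaffian_cong:
  assumes "\<And>i j. i < 2 * N \<Longrightarrow> j < 2 * N \<Longrightarrow> A i j = B i j"
  shows "pfaffian N A = pfaffian N B"
proof -
  have "A (\<sigma> (2 * i)) (\<sigma> (2 * i + 1)) = B (\<sigma> (2 * i)) (\<sigma> (2 * i + 1))"
    if "\<sigma> \<in> matching_perms N" "i < N" for \<sigma> i
  proof -
    have "\<sigma> permutes {..<2 * N}"
      using that by (simp add: matching_perms_def)
    then have "\<sigma> x < 2 * N" if "x < 2 * N" for x
      using that permutes_in_image by fastforce
    then show ?thesis
      using that(2) by (intro assms) auto
  qed
  then show ?thesis
    unfolding pfaffian_def by (intro sum.cong prod.cong arg_cong2[where f = "(*)"]) auto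
qed

text \<open>
  A matching in which \<open>0\<close> is paired with \<open>j + 1\<close> is the permutation \<open>cyc j \<circ> lift2 \<sigma>\<close>, where \<open>\<sigma>\<close> is the
  matching induced on the remaining points, renumbered from \<open>0\<close>.
\<close>

definition lift2 :: "(nat \<Rightarrow> nat) \<Rightarrow> nat \<Rightarrow> nat" where
  "lift2 \<sigma> x = (if x < 2 then x else \<sigma> (x - 2) + 2)"

definition cyc :: "nat \<Rightarrow> nat \<Rightarrow> nat" where
  "cyc j x = (if x = 0 then 0 else if x = 1 then j + 1 else if x \<le> j + 1 then x - 1 else x)"

text \<open>Transport along the shift \<open>i + 2\<close> makes the general facts on the sign and
  support of a transported permutation available.\<close>

lemma lift2_eq_map_permutation:
  assumes "\<sigma> permutes {..<n}"
  shows "lift2 \<sigma> = map_permutation {..<n} (\<lambda>i. i + 2) \<sigma>"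
proof
  fix x
  have img: "(\<lambda>i. i + 2) ` {..<n} = {2..<n + 2}"
    by (auto simp: image_iff Bex_def) presburger
  show "lift2 \<sigma> x = map_permutation {..<n} (\<lambda>i. i + 2) \<sigma> x"
  proof (cases "2 \<le> x \<and> x < n + 2")
    case True
    then have "map_permutation {..<n} (\<lambda>i. i + 2) \<sigma> ((x - 2) + 2) = \<sigma> (x - 2) + 2"
      by (intro map_permutation_apply) (auto simp: inj_on_def)
    with True show ?thesis by (simp only: lift2_def le_add_diff_inverse2) simp
  next
    case False
    then have "map_permutation {..<n} (\<lambda>i. i + 2) \<sigma> x = x"
      unfolding map_permutation_def img using False by (auto simp: restrict_id_def)
    moreover have "lift2 \<sigma> x = x"
      using False permutes_not_in[OF assms, of "x - 2"] by (auto simp: lift2_def)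
    ultimately show ?thesis by simp
  qed
qed

lemma sign_lift2: "\<sigma> permutes {..<n} \<Longrightarrow> sign (lift2 \<sigma>) = sign \<sigma>"
  unfolding lift2_eq_map_permutation by (rule sign_map_permutation) (auto simp: inj_on_def)

lemma lift2_permutes:
  assumes "\<sigma> permutes {..<n}"
  shows "lift2 \<sigma> permutes {..<Suc (Suc n)}"
proof -
  have "bij_betw (\<lambda>i. i + 2) {..<n} {2..<n + 2}"
    by (rule bij_betw_byWitness[where f' = "\<lambda>i. i - 2"]) auto
  then have "lift2 \<sigma> permutes {2..<n + 2}"
    using assms map_permutation_permutes by (simp add: lift2_eq_map_permutation)
  then show ?thesis by (rule permutes_subset) auto
qed

lemma cyc_0: "cyc 0 = id"
  by (auto simp: cyc_def)

text \<open>Building the cycle from \<open>j\<close> adjacent transpositions yields both its support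
  and its sign by induction.\<close>

lemma cyc_Suc: "cyc (Suc j) = Transposition.transpose (j + 1) (j + 2) \<circ> cyc j"
  by (auto simp: cyc_def fun_eq_iff Transposition.transpose_def)

lemma cyc_permutes: "j < n \<Longrightarrow> cyc j permutes {..<Suc n}"
proof (induction j)
  case (Suc j)
  then show ?case
    unfolding cyc_Suc by (intro permutes_compose permutes_swap_id) auto
qed (simp add: cyc_0 permutes_id)

lemma sign_cyc: "sign (cyc j) = (- 1) ^ j"
proof (induction j)
  case (Suc j)
  have "permutation (cyc j)"
    using cyc_permutes[of j "Suc j"] by (meson finite_lessThan lessI permutation_permutes)
  then show ?case
    unfolding cyc_Suc by (subst sign_compose) (simp_all add: permutation_swap_id sign_swap_id Suc)
qed (simp add: cyc_0)

lemma cyc_less_iff: "2 \<le> a \<Longrightarrow> 2 \<le> b \<Longrightarrow> cyc j a < cyc j b \<longleftrightarrow> a < b"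
  by (auto simp: cyc_def)

lemma cyc_Suc_Suc: "cyc j (Suc (Suc a)) = (if a < j then a + 1 else a + 2)"
  by (auto simp: cyc_def)

text \<open>\<open>cyc j\<close> is increasing on the points from 2 on, so the order conditions
  carry over from \<open>\<sigma>\<close>; the new first pair is \<open>(0, j + 1)\<close>.\<close>

lemma comp_lift2_in_matching_perms:
  assumes "\<sigma> \<in> matching_perms N" "j < 2 * N + 1"
  shows "cyc j \<circ> lift2 \<sigma> \<in> matching_perms (Suc N)"
proof -
  let ?\<tau> = "cyc j \<circ> lift2 \<sigma>"
  have \<sigma>: "\<sigma> permutes {..<2 * N}" "\<And>i. i < N \<Longrightarrow> \<sigma> (2 * i) < \<sigma> (Suc (2 * i))"
    "\<And>i k. i < k \<Longrightarrow> k < N \<Longrightarrow> \<sigma> (2 * i) < \<sigma> (2 * k)"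
    using assms(1) by (auto simp: matching_perms_def)
  have "?\<tau> permutes {..<2 * Suc N}"
    using permutes_compose[OF lift2_permutes[OF \<sigma>(1)], of "cyc j"] cyc_permutes[of j "Suc (2 * N)"] assms(2)
    by simp
  moreover have "?\<tau> (2 * i) < ?\<tau> (2 * i + 1)" if "i < Suc N" for i
  proof (cases i)
    case 0
    then show ?thesis by (simp add: lift2_def cyc_def)
  next
    case (Suc m)
    then show ?thesis using that \<sigma>(2)[of m] by (simp add: lift2_def cyc_less_iff)
  qed
  moreover have "?\<tau> (2 * i) < ?\<tau> (2 * k)" if ik: "i < k" "k < Suc N" for i k
  proof (cases i)
    case 0
    then show ?thesis using ik by (auto simp: lift2_def cyc_def)
  next
    case (Suc m)
    with ik(1) obtain l where "k = Suc l" by (cases k) auto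
    then show ?thesis using ik Suc \<sigma>(3)[of m l] by (simp add: lift2_def cyc_less_iff)
  qed
  ultimately show ?thesis by (auto simp: matching_perms_def)
qed

text \<open>The partner of 0 determines \<open>j\<close>; undoing \<open>cyc j\<close> leaves a
  permutation fixing 0 and 1, which is renumbered by subtracting 2.\<close>

lemma matching_perms_SucE:
  assumes "\<tau> \<in> matching_perms (Suc N)"
  obtains \<sigma> j where "\<sigma> \<in> matching_perms N" "j < 2 * N + 1" "\<tau> = cyc j \<circ> lift2 \<sigma>"
proof -
  have \<tau>: "\<tau> permutes {..<2 * N + 2}" "\<And>i. i < Suc N \<Longrightarrow> \<tau> (2 * i) < \<tau> (Suc (2 * i))"
    "\<And>i k. i < k \<Longrightarrow> k < Suc N \<Longrightarrow> \<tau> (2 * i) < \<tau> (2 * k)"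
    using assms by (auto simp: matching_perms_def)
  \<comment> \<open>The preimage of 0 lies in pair number \<open>x div 2\<close>. The first entry of
    a pair is its smaller one and first entries increase, so no value lies below
    \<open>\<tau> 0\<close>.\<close>
  have \<tau>0: "\<tau> 0 = 0"
  proof -
    obtain x where x: "\<tau> x = 0" using permutes_surj[OF \<tau>(1)] by (metis surjD)
    have "x < 2 * N + 2"
      using permutes_not_in[OF \<tau>(1), of x] x by (cases "x < 2 * N + 2") auto
    then have k: "x div 2 < Suc N" by auto
    then have "\<tau> (2 * (x div 2)) \<le> \<tau> x"
      using \<tau>(2)[of "x div 2"]
      by (metis less_imp_le_nat odd_two_times_div_two_succ dvd_mult_div_cancel order_refl Suc_eq_plus1)
    moreover have "\<tau> 0 \<le> \<tau> (2 * (x div 2))"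
      using \<tau>(3)[of 0 "x div 2"] k by (cases "x div 2") auto
    ultimately show ?thesis using x by simp
  qed
  have inj: "\<tau> x = \<tau> y \<longleftrightarrow> x = y" for x y
    using permutes_inj[OF \<tau>(1)] by (simp add: inj_eq)
  define j where "j = \<tau> 1 - 1"
  have "\<tau> 1 \<noteq> 0" using inj[of 1 0] \<tau>0 by simp
  then have j: "\<tau> (Suc 0) = Suc j" by (simp add: j_def)
  have "\<tau> 1 < 2 * N + 2" using permutes_in_image[OF \<tau>(1), of 1] by simp
  then have jN: "j < 2 * N + 1" using j by simp
  have c: "cyc j permutes {..<2 * N + 2}"
    using cyc_permutes[of j "2 * N + 1"] jN by simp
  define \<rho> where "\<rho> = inv (cyc j) \<circ> \<tau>"
  have c_\<rho>: "cyc j (\<rho> x) = \<tau> x" for x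
    using permutes_inverses(1)[OF c] by (simp add: \<rho>_def)
  have cyc_inj: "cyc j x = cyc j y \<longleftrightarrow> x = y" for x y
    using permutes_inj[OF c] by (simp add: inj_eq)
  have "cyc j (\<rho> 0) = cyc j 0" "cyc j (\<rho> 1) = cyc j 1"
    unfolding c_\<rho> by (auto simp: \<tau>0 j cyc_def)
  then have \<rho>01: "\<rho> 0 = 0" "\<rho> 1 = 1" by (simp_all only: cyc_inj)
  have \<rho>p: "\<rho> permutes {..<2 * N + 2}"
    unfolding \<rho>_def by (intro permutes_compose \<tau>(1) permutes_inv c)
  then have \<rho>p2: "\<rho> permutes {2..<2 * N + 2}"
    using \<rho>01 unfolding permutes_def
    by (metis atLeastLessThan_iff lessThan_iff less_2_cases not_le_imp_less One_nat_def)
  define \<sigma> where "\<sigma> = map_permutation {2..<2 * N + 2} (\<lambda>i. i - 2) \<rho>"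
  have "bij_betw (\<lambda>i. i - 2) {2..<2 * N + 2} {..<2 * N}"
    by (rule bij_betw_byWitness[where f' = "\<lambda>i. i + 2"]) auto
  then have \<sigma>p: "\<sigma> permutes {..<2 * N}"
    unfolding \<sigma>_def using \<rho>p2 by (rule map_permutation_permutes)
  have \<rho>ge: "2 \<le> \<rho> x" if "2 \<le> x" for x
  proof (cases "x < 2 * N + 2")
    case True
    then show ?thesis using permutes_in_image[OF \<rho>p2, of x] that by simp
  next
    case False
    then show ?thesis using permutes_not_in[OF \<rho>p2, of x] that by simp
  qed
  have \<sigma>: "\<sigma> x + 2 = \<rho> (x + 2)" for x
  proof (cases "x < 2 * N")
    case True
    have "\<sigma> ((x + 2) - 2) = \<rho> (x + 2) - 2"
      unfolding \<sigma>_def by (rule map_permutation_apply) (use True in \<open>auto simp: inj_on_def\<close>)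
    then show ?thesis using \<rho>ge[of "x + 2"] by simp
  next
    case False
    then show ?thesis
      using permutes_not_in[OF \<sigma>p, of x] permutes_not_in[OF \<rho>p2, of "x + 2"] by simp
  qed
  have lift: "lift2 \<sigma> = \<rho>"
  proof
    fix x
    show "lift2 \<sigma> x = \<rho> x"
    proof (cases "x < 2")
      case True
      then show ?thesis using \<rho>01 less_2_cases[of x] by (auto simp: lift2_def)
    next
      case False
      then show ?thesis using \<sigma>[of "x - 2"] le_add_diff_inverse2[of 2 x] by (simp add: lift2_def)
    qed
  qed
  have eq: "\<tau> = cyc j \<circ> lift2 \<sigma>"
    by (simp add: lift fun_eq_iff c_\<rho>)
  have \<tau>2: "\<tau> (x + 2) = cyc j (\<sigma> x + 2)" for x
    by (simp only: \<sigma> c_\<rho>)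
  have "\<sigma> (2 * i) < \<sigma> (2 * i + 1)" if "i < N" for i
    using \<tau>(2)[of "Suc i"] that \<tau>2[of "2 * i"] \<tau>2[of "2 * i + 1"] by (simp add: cyc_less_iff)
  moreover have "\<sigma> (2 * i) < \<sigma> (2 * k)" if "i < k" "k < N" for i k
    using \<tau>(3)[of "Suc i" "Suc k"] that \<tau>2[of "2 * i"] \<tau>2[of "2 * k"] by (simp add: cyc_less_iff)
  ultimately have "\<sigma> \<in> matching_perms N"
    using \<sigma>p by (auto simp: matching_perms_def)
  then show thesis using jN eq that by blast
qed

text \<open>The value at 1 recovers \<open>j\<close>, and then the values from 2 on recover
  \<open>\<sigma>\<close>.\<close>

lemma inj_on_comp_lift2: "inj_on (\<lambda>(j, \<sigma>). cyc j \<circ> lift2 \<sigma>) UNIV"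
proof (rule inj_onI, clarify)
  fix j \<sigma> k \<sigma>'
  assume eq: "cyc j \<circ> lift2 \<sigma> = cyc k \<circ> lift2 \<sigma>'"
  from fun_cong[OF eq, of 1] have "j = k" by (simp add: lift2_def cyc_def)
  have "\<sigma> x = \<sigma>' x" for x
    using fun_cong[OF eq, of "x + 2"] \<open>j = k\<close>
    by (simp add: lift2_def cyc_def split: if_splits)
  then show "j = k \<and> \<sigma> = \<sigma>'" using \<open>j = k\<close> by auto
qed

text \<open>Matchings are grouped by the partner \<open>j + 1\<close> of 0. \<open>cyc j\<close>
  contributes the sign and numbers the remaining points in increasing order.\<close>

lemma pfaffian_Suc:
  "pfaffian (Suc N) A =
     (\<Sum>j<2 * N + 1. (- 1) ^ j * A 0 (j + 1) * pfaffian N (\<lambda>a b. A (cyc j (a + 2)) (cyc j (b + 2))))"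
proof -
  have image: "matching_perms (Suc N) = (\<lambda>(j, \<sigma>). cyc j \<circ> lift2 \<sigma>) ` ({..<2 * N + 1} \<times> matching_perms N)"
    using comp_lift2_in_matching_perms by (force elim: matching_perms_SucE)
  define h where "h \<tau> = of_int (sign \<tau>) * (\<Prod>i<Suc N. A (\<tau> (2 * i)) (\<tau> (2 * i + 1)))" for \<tau>
  have summand: "h (cyc j \<circ> lift2 \<sigma>) =
      (- 1) ^ j * A 0 (j + 1) *
        (of_int (sign \<sigma>) * (\<Prod>i<N. A (cyc j (\<sigma> (2 * i) + 2)) (cyc j (\<sigma> (2 * i + 1) + 2))))"
    if "\<sigma> \<in> matching_perms N" for j \<sigma>
  proof -
    have \<sigma>: "\<sigma> permutes {..<2 * N}" using that by (simp add: matching_perms_def)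
    have "permutation (cyc j)"
      using cyc_permutes[of j "Suc j"] by (meson finite_lessThan lessI permutation_permutes)
    moreover have "permutation (lift2 \<sigma>)"
      using lift2_permutes[OF \<sigma>] by (meson finite_lessThan permutation_permutes)
    ultimately have "sign (cyc j \<circ> lift2 \<sigma>) = (- 1) ^ j * sign \<sigma>"
      by (simp add: sign_compose sign_cyc sign_lift2[OF \<sigma>])
    moreover have "(\<Prod>i<Suc N. A ((cyc j \<circ> lift2 \<sigma>) (2 * i)) ((cyc j \<circ> lift2 \<sigma>) (2 * i + 1))) =
        A 0 (j + 1) * (\<Prod>i<N. A (cyc j (\<sigma> (2 * i) + 2)) (cyc j (\<sigma> (2 * i + 1) + 2)))"
      unfolding prod.lessThan_Suc_shift by (simp add: lift2_def) (simp add: cyc_def)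
    ultimately show ?thesis unfolding h_def by (simp only: of_int_mult of_int_power of_int_minus of_int_1 mult_ac)
  qed
  have "pfaffian (Suc N) A = (\<Sum>(j, \<sigma>)\<in>{..<2 * N + 1} \<times> matching_perms N. h (cyc j \<circ> lift2 \<sigma>))"
    unfolding pfaffian_def h_def[symmetric] image
    by (subst sum.reindex[OF inj_on_subset[OF inj_on_comp_lift2 subset_UNIV]])
      (simp add: case_prod_unfold)
  then show ?thesis
    unfolding pfaffian_def sum_distrib_left sum.cartesian_product[symmetric]
    by (simp only: summand cong: sum.cong)
qed

section \<open>Expansion along the first symbol of a list\<close>

definition del :: "nat \<Rightarrow> 'a list \<Rightarrow> 'a list" where
  "del j xs = take j xs @ drop (Suc j) xs"

lemma length_del [simp]: "j < length xs \<Longrightarrow> length (del j xs) = length xs - 1"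
  by (simp add: del_def)

lemma nth_del: "j < length xs \<Longrightarrow> a < length xs - 1 \<Longrightarrow> del j xs ! a = xs ! (if a < j then a else a + 1)"
  by (auto simp: del_def nth_append)

lemma Pf_Nil [simp]: "Pf e [] = 1"
proof -
  have "matching_perms 0 = {id}"
    by (auto simp: matching_perms_def)
  then show ?thesis by (simp add: Pf_def pfaffian_def)
qed

text \<open>Once \<open>x\<close> and \<open>xs ! j\<close> are removed, the indices
  \<open>cyc j (a + 2)\<close> run through \<open>del j xs\<close> in order.\<close>

lemma Pf_Cons:
  assumes "odd (length xs)"
  shows "Pf e (x # xs) = (\<Sum>j<length xs. (- 1) ^ j * e x (xs ! j) * Pf e (del j xs))"
proof -
  obtain N where N: "length xs = 2 * N + 1" using assms by (elim oddE)
  have "pfaffian N (\<lambda>a b. e ((x # xs) ! cyc j (a + 2)) ((x # xs) ! cyc j (b + 2))) = Pf e (del j xs)"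
    if "j < length xs" for j
    unfolding Pf_def using that N
    by (intro trans[OF pfaffian_cong arg_cong2[where f = pfaffian]])
      (auto simp: cyc_Suc_Suc nth_del)
  then show ?thesis
    unfolding Pf_def[of e "x # xs"] using N by (simp add: pfaffian_Suc del: sum.lessThan_Suc)
qed

lemma del_append_left: "j < length xs \<Longrightarrow> del j (xs @ ys) = del j xs @ ys"
  by (simp add: del_def)

lemma del_append_right: "del (length xs + j) (xs @ ys) = xs @ del j ys"
  by (simp add: del_def)

lemma del_0 [simp]: "del 0 (x # xs) = xs"
  by (simp add: del_def)

lemma del_Suc [simp]: "del (Suc j) (x # xs) = x # del j xs"
  by (simp add: del_def)

lemma del_del:
  assumes "k < j" "j < length xs"
  shows "del k (del j xs) = del (j - 1) (del k xs)"
  by (rule nth_equalityI) (use assms in \<open>auto simp: nth_del\<close>)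

section \<open>Consequences of skew-symmetry\<close>

text \<open>If the two symbols lead the list, expanding along both gives a double sum that is
  antisymmetric in them. Otherwise one expands along the leading symbol and applies induction to the
  terms that keep both.\<close>

lemma Pf_swap:
  assumes skew: "\<And>a b. e a b = - e b a"
    and "even (length xs + length ys)"
  shows "Pf e (xs @ a # b # ys) = - Pf e (xs @ b # a # ys)"
  using assms(2)
proof (induction "length xs + length ys" arbitrary: xs ys a b rule: less_induct)
  case less
  note even = less.prems
  show ?case
  proof (cases xs)
    case Nil
    let ?m = "length ys"
    have ev: "even ?m" using even Nil by simp
    \<comment> \<open>The terms of the double expansion in which \<open>a\<close> and
      \<open>b\<close> are not matched with each other.\<close>
    define T where "T a b = (\<Sum>(j, k)\<in>{..<?m} \<times> {..<?m - 1}.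
        (- 1) ^ (j + k) * e a (ys ! j) * e b (del j ys ! k) * Pf e (del k (del j ys)))" for a b
    have expand: "Pf e (a # b # ys) = e a b * Pf e ys - T a b" for a b
    proof -
      have "Pf e (a # b # ys) = e a b * Pf e ys -
          (\<Sum>j<?m. (- 1) ^ j * e a (ys ! j) * Pf e (b # del j ys))"
        using ev by (subst Pf_Cons) (simp_all add: sum.lessThan_Suc_shift sum_negf del: sum.lessThan_Suc)
      also have "(\<Sum>j<?m. (- 1) ^ j * e a (ys ! j) * Pf e (b # del j ys)) = T a b"
        unfolding T_def sum.cartesian_product[symmetric]
        using ev by (intro sum.cong refl, subst Pf_Cons)
          (auto simp: sum_distrib_left power_add mult_ac intro!: sum.cong)
      finally show ?thesis .
    qed
    \<comment> \<open>\<open>w\<close> removes the same two positions in the opposite order, which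
      exchanges the partners of \<open>a\<close> and \<open>b\<close>. It is an involution and flips
      the parity of \<open>j + k\<close>.\<close>
    define w where "w = (\<lambda>(j, k). if k < j then (k, j - 1) else (k + 1, j :: nat))"
    have "T a b = (\<Sum>(j, k)\<in>{..<?m} \<times> {..<?m - 1}.
        - ((- 1) ^ (j + k) * e b (ys ! j) * e a (del j ys ! k) * Pf e (del k (del j ys))))"
      unfolding T_def
    proof (rule sum.reindex_bij_witness[where i = w and j = w], goal_cases)
      case (5 p)
      obtain j k where p: "p = (j, k)" by fastforce
      with 5 have jk: "j < ?m" "k < ?m - 1" by auto
      show ?case
      proof (cases "k < j")
        case True
        then obtain i where "j = Suc i" by (cases j) auto
        then show ?thesis
          using True jk by (simp add: p w_def nth_del del_del[of k "Suc i"] power_add mult_ac)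
      next
        case False
        then show ?thesis
          using jk by (simp add: p w_def nth_del del_del[of j "Suc k"] power_add mult_ac)
      qed
    qed (auto simp: w_def split: if_splits)
    also have "\<dots> = - T b a"
      unfolding T_def by (simp add: sum_negf case_prod_unfold)
    finally have "T a b = - T b a" .
    then show ?thesis using Nil expand[of a b] expand[of b a] skew[of a b] by simp
  next
    case (Cons x zs)
    let ?m = "length zs"
    let ?n = "?m + 2 + length ys"
    define F where "F a b j = (- 1) ^ j * e x ((zs @ a # b # ys) ! j) * Pf e (del j (zs @ a # b # ys))"
      for a b j
    have expand: "Pf e (xs @ a # b # ys) = (\<Sum>j<?n. F a b j)" for a b
      unfolding F_def using even Cons by (simp add: Pf_Cons)
    \<comment> \<open>Transposing the positions of \<open>a\<close> and \<open>b\<close> matches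
      terms that remove the same symbol. If that symbol is \<open>a\<close> or \<open>b\<close>, the
      sign comes from its position, otherwise from the induction hypothesis.\<close>
    have F: "F a b (Transposition.transpose ?m (?m + 1) j) = - F b a j" if j: "j < ?n" for j
    proof -
      consider "j < ?m" | "j = ?m" | "j = ?m + 1" | i where "j = ?m + (2 + i)" "i < length ys"
      proof (atomize_elim, cases "j < ?m + 2")
        case True
        then show "j < ?m \<or> j = ?m \<or> j = ?m + 1 \<or> (\<exists>i. j = ?m + (2 + i) \<and> i < length ys)"
          by linarith
      next
        case False
        then have "j = ?m + (2 + (j - ?m - 2)) \<and> j - ?m - 2 < length ys" using j by linarith
        then show "j < ?m \<or> j = ?m \<or> j = ?m + 1 \<or> (\<exists>i. j = ?m + (2 + i) \<and> i < length ys)"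
          by blast
      qed
      then show ?thesis
      proof cases
        case 1
        then have "Pf e (del j zs @ a # b # ys) = - Pf e (del j zs @ b # a # ys)"
          using even Cons by (intro less.hyps) auto
        then show ?thesis using 1 by (simp add: F_def Transposition.transpose_def del_append_left nth_append)
      next
        case 2
        then show ?thesis
          using del_append_right[of zs 0 "b # a # ys"] del_append_right[of zs 1 "a # b # ys"]
          by (simp add: F_def nth_append)
      next
        case 3
        then show ?thesis
          using del_append_right[of zs 1 "b # a # ys"] del_append_right[of zs 0 "a # b # ys"]
          by (simp add: F_def nth_append)
      next
        case 4
        then have "Pf e (zs @ a # b # del i ys) = - Pf e (zs @ b # a # del i ys)"
          using even Cons by (intro less.hyps) auto
        then show ?thesis
          using 4 del_append_right[of zs "2 + i" "b # a # ys"] del_append_right[of zs "2 + i" "a # b # ys"]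
          by (simp add: F_def Transposition.transpose_def nth_append)
      qed
    qed
    have "(\<Sum>j<?n. F a b j) = (\<Sum>j<?n. F a b (Transposition.transpose ?m (?m + 1) j))"
      by (rule sum.permute[unfolded comp_def]) (rule permutes_swap_id, auto)
    also have "\<dots> = - (\<Sum>j<?n. F b a j)"
      unfolding sum_negf[symmetric] by (intro sum.cong refl F) simp
    finally show ?thesis by (simp add: expand)
  qed
qed

lemma Pf_move:
  assumes skew: "\<And>a b. e a b = - e b a"
    and "odd (length (xs @ ys @ zs))"
  shows "Pf e (xs @ a # ys @ zs) = (- 1) ^ length ys * Pf e (xs @ ys @ a # zs)"
  using assms(2)
proof (induction ys arbitrary: xs)
  case (Cons y ys)
  have "Pf e (xs @ a # y # ys @ zs) = - Pf e ((xs @ [y]) @ a # ys @ zs)"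
    using Pf_swap[where e = e and xs = xs and ys = "ys @ zs" and a = a and b = y, OF skew] Cons.prems by simp
  then show ?case using Cons.IH[of "xs @ [y]"] Cons.prems by simp
qed simp

text \<open>Moving \<open>z\<close> to the front past an odd number of symbols costs a sign, which
  the skewness of the entries gives back.\<close>

lemma Pf_snoc:
  assumes skew: "\<And>a b. e a b = - e b a" and "odd (length xs)"
  shows "Pf e (xs @ [z]) = (\<Sum>j<length xs. (- 1) ^ j * Pf e (del j xs) * e (xs ! j) z)"
proof -
  have "Pf e (z # xs) = - Pf e (xs @ [z])"
    using Pf_move[where e = e and xs = "[]" and ys = xs and zs = "[]" and a = z, OF skew] assms(2) by simp
  then have "Pf e (xs @ [z]) = - Pf e (z # xs)" by simp
  also have "\<dots> = (\<Sum>j<length xs. - ((- 1) ^ j * e z (xs ! j) * Pf e (del j xs)))"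
    using assms(2) by (simp add: Pf_Cons sum_negf)
  also have "\<dots> = (\<Sum>j<length xs. (- 1) ^ j * Pf e (del j xs) * e (xs ! j) z)"
    by (intro sum.cong refl, subst skew[of z]) simp
  finally show ?thesis .
qed

text \<open>With the two equal symbols made adjacent, swapping them gives \<open>x = - x\<close>,
  which forces 0 over the reals.\<close>

lemma Pf_not_distinct:
  fixes e :: "'s \<Rightarrow> 's \<Rightarrow> real"
  assumes skew: "\<And>a b. e a b = - e b a"
    and "even (length xs)" "\<not> distinct xs"
  shows "Pf e xs = 0"
proof -
  obtain us vs ws a where xs: "xs = us @ [a] @ vs @ [a] @ ws"
    using not_distinct_decomp[OF assms(3)] by auto
  have "even (length (us @ vs) + length ws)"
    using assms(2) by (simp add: xs) argo
  then have "Pf e ((us @ vs) @ a # a # ws) = - Pf e ((us @ vs) @ a # a # ws)"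
    by (rule Pf_swap[OF skew])
  then have "Pf e (us @ vs @ a # a # ws) = 0" by simp
  moreover have "odd (length (us @ vs @ a # ws))"
    using assms(2) by (simp add: xs)
  then have "Pf e (us @ a # vs @ a # ws) = (- 1) ^ length vs * Pf e (us @ vs @ a # a # ws)"
    by (rule Pf_move[OF skew])
  ultimately show ?thesis by (simp add: xs)
qed

lemma Pf_map: "Pf e (map f xs) = Pf (\<lambda>a b. e (f a) (f b)) xs"
  unfolding Pf_def by (auto intro!: pfaffian_cong)

lemma Pf_zero_row:
  assumes skew: "\<And>a b. e a b = - e b a"
    and "even (length xs)" "a \<in> set xs" "\<And>b. e a b = 0"
  shows "Pf e xs = 0"
proof -
  obtain us vs where xs: "xs = us @ a # vs"
    using split_list[OF assms(3)] by auto
  then have "odd (length ([] @ us @ vs))"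
    using assms(2) by simp
  then have "Pf e ([] @ a # us @ vs) = (- 1) ^ length us * Pf e ([] @ us @ a # vs)"
    by (rule Pf_move[OF skew])
  moreover have "Pf e (a # us @ vs) = 0"
    using assms(2,4) by (subst Pf_Cons) (auto simp: xs)
  ultimately show ?thesis by (cases "even (length us)") (simp_all add: xs)
qed

text \<open>Identifies the cofactors of \<open>z\<close>, which do not involve \<open>z\<close>,
  with real Pfaffians.\<close>

lemma Pf_const_poly:
  "even (length xs) \<Longrightarrow> Pf (\<lambda>a b. [:e a b:]) xs = [:Pf e xs:]"
proof (induction "length xs" arbitrary: xs rule: less_induct)
  case less
  show ?case
  proof (cases xs)
    case (Cons x ys)
    have "odd (length ys)" using less.prems Cons by simp
    have "Pf (\<lambda>a b. [:e a b:]) (del j ys) = [:Pf e (del j ys):]" if "j < length ys" for j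
      using less Cons that by simp
    then show ?thesis
      unfolding Cons Pf_Cons[OF \<open>odd (length ys)\<close>]
      by (auto simp: sum_to_poly[symmetric] minus_one_power_iff mult.commute intro!: sum.cong)
  qed (simp add: one_pCons)
qed

text \<open>Each position occurs in exactly one factor of every matching term, so the product rule
  applies \<open>S\<close> to one position at a time.\<close>

lemma has_real_derivative_Pf:
  assumes e: "\<And>a b. ((\<lambda>t. e t a b) has_real_derivative e t (S a) b + e t a (S b)) (at t)"
    and "even (length xs)"
  shows "((\<lambda>t. Pf (e t) xs) has_real_derivative
    (\<Sum>p<length xs. Pf (e t) (xs[p := S (xs ! p)]))) (at t)"
  using assms(2)
proof (induction "length xs" arbitrary: xs rule: less_induct)
  case less
  show ?case
  proof (cases xs)
    case (Cons x ys)
    let ?n = "length ys"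
    have n: "odd ?n" using less.prems Cons by simp
    define D where "D j = (\<Sum>p<length (del j ys). Pf (e t) ((del j ys)[p := S (del j ys ! p)]))" for j
    have D: "((\<lambda>t. Pf (e t) (del j ys)) has_real_derivative D j) (at t)" if "j < ?n" for j
      unfolding D_def using that less.prems Cons n by (intro less.hyps) auto
    have "((\<lambda>t. Pf (e t) xs) has_real_derivative (\<Sum>j<?n. (- 1) ^ j *
        ((e t (S x) (ys ! j) + e t x (S (ys ! j))) * Pf (e t) (del j ys) + D j * e t x (ys ! j)))) (at t)"
      unfolding Cons Pf_Cons[OF n] mult.assoc
      by (intro DERIV_sum DERIV_cmult DERIV_mult D e) simp
    also have "(\<Sum>j<?n. (- 1) ^ j *
        ((e t (S x) (ys ! j) + e t x (S (ys ! j))) * Pf (e t) (del j ys) + D j * e t x (ys ! j))) =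
      Pf (e t) (S x # ys) + (\<Sum>j<?n. (- 1) ^ j *
        (e t x (S (ys ! j)) * Pf (e t) (del j ys) + D j * e t x (ys ! j)))"
      unfolding Pf_Cons[OF n] by (simp add: sum.distrib[symmetric] algebra_simps)
    also have "(\<Sum>j<?n. (- 1) ^ j *
        (e t x (S (ys ! j)) * Pf (e t) (del j ys) + D j * e t x (ys ! j))) =
      (\<Sum>j<?n. \<Sum>q<?n. (- 1) ^ j *
        e t x (ys[q := S (ys ! q)] ! j) * Pf (e t) (del j (ys[q := S (ys ! q)])))"
    proof (rule sum.cong[OF refl])
      fix j assume "j \<in> {..<?n}"
      then have j: "j < ?n" by simp
      \<comment> \<open>Positions of the shortened list are renumbered as positions of
        \<open>ys\<close>. The missing position \<open>j\<close> is supplied by the derivative of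
        the entry pairing \<open>x\<close> with \<open>ys ! j\<close>.\<close>
      have "D j = (\<Sum>q\<in>{..<?n} - {j}. Pf (e t) (del j (ys[q := S (ys ! q)])))"
        unfolding D_def
      proof (rule sum.reindex_bij_witness[where i = "\<lambda>q. if q < j then q else q - 1" and
              j = "\<lambda>p. if p < j then p else p + 1"], goal_cases)
        case (5 p)
        then have "del j (ys[(if p < j then p else p + 1) := S (ys ! (if p < j then p else p + 1))]) =
            (del j ys)[p := S (del j ys ! p)]"
          using j by (intro nth_equalityI) (auto simp: nth_del nth_list_update split: if_splits)
        then show ?case by simp
      qed (use j in \<open>auto split: if_splits\<close>)
      moreover have "del j (ys[j := S (ys ! j)]) = del j ys"
        using j by (intro nth_equalityI) (auto simp: nth_del nth_list_update)
      ultimately show "(- 1) ^ j *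
          (e t x (S (ys ! j)) * Pf (e t) (del j ys) + D j * e t x (ys ! j)) =
        (\<Sum>q<?n. (- 1) ^ j *
          e t x (ys[q := S (ys ! q)] ! j) * Pf (e t) (del j (ys[q := S (ys ! q)])))"
        using j by (simp add: sum.remove[of "{..<?n}" j] sum_distrib_left sum_distrib_right algebra_simps)
    qed
    also have "\<dots> = (\<Sum>q<?n. Pf (e t) (x # ys[q := S (ys ! q)]))"
      by (subst sum.swap) (simp add: Pf_Cons n)
    finally show ?thesis
      by (simp add: Cons sum.lessThan_Suc_shift del: sum.lessThan_Suc)
  qed simp
qed

subsection \<open>Coefficients of a polynomial as arguments of a linear functional\<close>

text \<open>The linear functional that sends \<open>z^i\<close> to \<open>a i\<close>.\<close>

definition lin :: "(nat \<Rightarrow> real) \<Rightarrow> real poly \<Rightarrow> real" where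
  "lin a p = (\<Sum>i\<le>degree p. coeff p i * a i)"

lemma lin_altdef: "degree p \<le> n \<Longrightarrow> lin a p = (\<Sum>i\<le>n. coeff p i * a i)"
  unfolding lin_def by (intro sum.mono_neutral_left) (auto simp: coeff_eq_0)

lemma lin_add: "lin a (p + q) = lin a p + lin a q"
  using lin_altdef[of "p + q" "max (degree p) (degree q)" a] lin_altdef[of p "max (degree p) (degree q)" a]
    lin_altdef[of q "max (degree p) (degree q)" a]
  by (simp add: degree_add_le_max sum.distrib distrib_right)

lemma lin_smult: "lin a (smult c p) = c * lin a p"
  using lin_altdef[of "smult c p" "degree p" a] by (simp add: lin_def sum_distrib_left mult.assoc)

lemma lin_diff: "lin a (p - q) = lin a p - lin a q"
  using lin_add[of a p "smult (- 1) q"] by (simp only: lin_smult) simp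

lemma lin_0 [simp]: "lin a 0 = 0"
  by (simp add: lin_def)

lemma lin_sum: "lin a (\<Sum>i\<in>I. f i) = (\<Sum>i\<in>I. lin a (f i))"
  by (induction I rule: infinite_finite_induct) (simp_all add: lin_add)

lemma lin_monom: "lin a (monom c i) = c * a i"
proof -
  have "lin a (monom c i) = (\<Sum>j\<le>i. if j = i then c * a i else 0)"
    unfolding lin_altdef[OF degree_monom_le] by (intro sum.cong) auto
  then show ?thesis by simp
qed

text \<open>Multiplication by \<open>z\<close> becomes a shift of the moment index.\<close>

lemma lin_pCons_0: "lin a (pCons 0 p) = lin (\<lambda>i. a (Suc i)) p"
  using lin_altdef[of "pCons 0 p" "Suc (degree p)" a]
  by (simp add: degree_pCons_le lin_def sum.atMost_Suc_shift del: sum.atMost_Suc)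

lemma lin_add_fun: "lin (\<lambda>i. a i + b i) p = lin a p + lin b p"
  by (simp add: lin_def distrib_left sum.distrib)

lemma lin_cmult_fun: "lin (\<lambda>i. c * a i) p = c * lin a p"
  by (simp add: lin_def sum_distrib_left mult.left_commute)

lemma lin_comb_fun: "lin (\<lambda>i. x * a i - y * b i) p = x * lin a p - y * lin b p"
  by (simp add: lin_def right_diff_distrib sum_subtractf sum_distrib_left mult.left_commute)

lemma lin_swap: "lin (\<lambda>i. lin (\<lambda>j. a i j) q) p = lin (\<lambda>j. lin (\<lambda>i. a i j) p) q"
  unfolding lin_def sum_distrib_left by (subst sum.swap) (simp add: mult.left_commute)

subsection \<open>The polynomials\<close>

text \<open>The symbol that makes the number of symbols even, so that both parities of
  \<open>k\<close> are treated together.\<close>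

definition pre :: "nat \<Rightarrow> symbol list" where
  "pre k = (if even k then [] else [D0])"

lemma length_pre: "length (pre k) = k mod 2"
  by (simp add: pre_def odd_iff_mod_2_eq_one)

lemma tau_eq: "tau \<rho> t (int k) = Pf (entry \<rho> t) (pre k @ map Idx [0..<k])"
  by (simp add: tau_def pre_def)

text \<open>The coefficient of \<open>z^i\<close> in \<open>\<tau>_k P_k\<close>; the summand
  \<open>k mod 2\<close> in the sign accounts for a leading \<open>D0\<close>.\<close>

definition cofac :: "(real \<Rightarrow> real) \<Rightarrow> real \<Rightarrow> nat \<Rightarrow> nat \<Rightarrow> real" where
  "cofac \<rho> t k i = (- 1) ^ (k mod 2 + i) * Pf (entry \<rho> t) (pre k @ map Idx (del i [0..<Suc k]))"

context
  fixes \<rho> :: "real \<Rightarrow> real" and t :: real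
  assumes moment_skew: "\<And>i j. moment \<rho> t i j = - moment \<rho> t j i"
begin

lemma entry_skew: "entry \<rho> t a b = - entry \<rho> t b a"
  by (cases a; cases b) (auto intro: moment_skew)

lemma zentry_skew: "zentry \<rho> t a b = - zentry \<rho> t b a"
proof -
  have "zentry \<rho> t (Sym a) (Sym b) = - zentry \<rho> t (Sym b) (Sym a)" for a b
    using entry_skew[of a b] by simp
  moreover have "zentry \<rho> t (Sym a) Z = - zentry \<rho> t Z (Sym a)" for a
    by (cases a) auto
  moreover have "zentry \<rho> t Z (Sym a) = - zentry \<rho> t (Sym a) Z" for a
    by (cases a) auto
  moreover have "zentry \<rho> t Z Z = - zentry \<rho> t Z Z"
    by simp
  ultimately show ?thesis by (metis zsymbol.exhaust)
qed

text \<open>Stated for arbitrary \<open>e\<close>, \<open>f\<close> and \<open>s\<close> so that it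
  covers both the symbol \<open>Z\<close> and its replacement by a real symbol. The separate summand
  pairs \<open>D0\<close> with \<open>s\<close>.\<close>

lemma Pf_symbols_snoc:
  assumes skew: "\<And>a b. e a b = - e b a"
  shows "Pf e (map f (pre k) @ map (f \<circ> Idx) [0..<Suc k] @ [s]) =
    (if even k then 0 else Pf e (map (f \<circ> Idx) [0..<Suc k]) * e (f D0) s) +
    (\<Sum>i\<le>k. (- 1) ^ (k mod 2 + i) * Pf e (map f (pre k) @ map (f \<circ> Idx) (del i [0..<Suc k])) * e (f (Idx i)) s)"
proof -
  let ?xs = "map (f \<circ> Idx) [0..<Suc k]"
  have map_del: "map (f \<circ> Idx) (del i [0..<Suc k]) = del i ?xs" for i
    by (simp only: del_def map_append take_map drop_map)
  have nth: "?xs ! i = f (Idx i)" if "i < Suc k" for i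
    using that by (simp del: upt_Suc)
  show ?thesis
  proof (cases "even k")
    case True
    then have "Pf e (?xs @ [s]) = (\<Sum>j<length ?xs. (- 1) ^ j * Pf e (del j ?xs) * e (?xs ! j) s)"
      by (intro Pf_snoc[OF skew]) simp
    also have "\<dots> = (\<Sum>i\<le>k. (- 1) ^ i * Pf e (del i ?xs) * e (f (Idx i)) s)"
      by (intro sum.cong) (auto simp: nth simp del: upt_Suc)
    finally show ?thesis using True by (simp add: pre_def map_del mod_2_eq_odd del: upt_Suc)
  next
    case False
    let ?ys = "f D0 # ?xs"
    have "Pf e (?ys @ [s]) = (\<Sum>j<length ?ys. (- 1) ^ j * Pf e (del j ?ys) * e (?ys ! j) s)"
      using False by (intro Pf_snoc[OF skew]) simp
    also have "\<dots> = (\<Sum>j<Suc (Suc k). (- 1) ^ j * Pf e (del j ?ys) * e (?ys ! j) s)"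
      by simp
    also have "\<dots> = Pf e ?xs * e (f D0) s +
        (\<Sum>i\<le>k. (- 1) ^ Suc i * Pf e (f D0 # del i ?xs) * e (f (Idx i)) s)"
      unfolding sum.lessThan_Suc_shift[of _ "Suc k"] lessThan_Suc_atMost[of k]
      by (intro arg_cong2[where f = "(+)"] sum.cong) (auto simp: nth simp del: upt_Suc)
    finally show ?thesis using False by (simp add: pre_def map_del mod_2_eq_odd del: upt_Suc)
  qed
qed

text \<open>Expansion along \<open>Z\<close>; the \<open>D0\<close> term vanishes because
  \<open>Pf(d_0, z) = 0\<close>.\<close>

lemma Ppoly_eq: "Ppoly \<rho> t (int k) = smult (1 / tau \<rho> t (int k)) (\<Sum>i\<le>k. monom (cofac \<rho> t k i) i)"
proof -
  have const: "Pf (zentry \<rho> t) (map Sym xs) = [:Pf (entry \<rho> t) xs:]" if "even (length xs)" for xs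
    using Pf_const_poly[OF that, of "entry \<rho> t"] by (simp add: Pf_map)
  have "Pf (zentry \<rho> t) (map Sym (pre k) @ map (Sym \<circ> Idx) [0..<Suc k] @ [Z]) =
    (\<Sum>i\<le>k. (- 1) ^ (k mod 2 + i) *
       Pf (zentry \<rho> t) (map Sym (pre k) @ map (Sym \<circ> Idx) (del i [0..<Suc k])) * zentry \<rho> t (Sym (Idx i)) Z)"
    by (subst Pf_symbols_snoc[OF zentry_skew]) (simp del: upt_Suc)
  also have "\<dots> = (\<Sum>i\<le>k. monom (cofac \<rho> t k i) i)"
  proof (rule sum.cong[OF refl])
    fix i assume "i \<in> {..k}"
    then have "even (length (pre k @ map Idx (del i [0..<Suc k])))"
      by (simp add: length_pre del: upt_Suc)
    from const[OF this] show "(- 1) ^ (k mod 2 + i) *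
        Pf (zentry \<rho> t) (map Sym (pre k) @ map (Sym \<circ> Idx) (del i [0..<Suc k])) * zentry \<rho> t (Sym (Idx i)) Z =
        monom (cofac \<rho> t k i) i"
      by (simp add: cofac_def smult_monom minus_one_power_iff minus_monom del: upt_Suc)
  qed
  finally show ?thesis
    by (auto simp: Ppoly_def pre_def nat_add_distrib simp del: upt_Suc)
qed

lemma coeff_Ppoly: "coeff (Ppoly \<rho> t (int k)) m = (if m \<le> k then cofac \<rho> t k m / tau \<rho> t (int k) else 0)"
  by (simp add: Ppoly_eq coeff_sum if_distrib)

lemma degree_Ppoly_le: "degree (Ppoly \<rho> t (int k)) \<le> k"
  by (rule degree_le) (simp add: coeff_Ppoly)

lemma del_upt_last: "del k [0..<Suc k] = [0..<k]"
  by (simp add: del_def)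

lemma coeff_Ppoly_lead: "tau \<rho> t (int k) \<noteq> 0 \<Longrightarrow> coeff (Ppoly \<rho> t (int k)) k = 1"
  by (simp add: coeff_Ppoly cofac_def del_upt_last tau_eq[symmetric] del: upt_Suc)

text \<open>Applying the functional replaces \<open>z\<close> by \<open>s\<close> in the Pfaffian,
  except that for odd \<open>k\<close> the term pairing \<open>D0\<close> with \<open>s\<close> has
  no counterpart in \<open>P_k\<close> and is subtracted.\<close>

lemma lin_Ppoly:
  assumes "tau \<rho> t (int k) \<noteq> 0"
  shows "tau \<rho> t (int k) * lin (\<lambda>i. entry \<rho> t (Idx i) s) (Ppoly \<rho> t (int k)) =
    Pf (entry \<rho> t) (pre k @ map Idx [0..<Suc k] @ [s]) -
    (if even k then 0 else tau \<rho> t (int k + 1) * entry \<rho> t D0 s)"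
proof -
  have "odd k \<Longrightarrow> tau \<rho> t (int k + 1) = Pf (entry \<rho> t) (map Idx [0..<Suc k])"
    using tau_eq[of \<rho> t "Suc k"] by (simp add: pre_def add.commute del: upt_Suc)
  then show ?thesis
    using Pf_symbols_snoc[where e = "entry \<rho> t" and f = "\<lambda>x. x" and k = k and s = s, OF entry_skew] assms
    by (simp add: Ppoly_eq lin_smult lin_sum lin_monom cofac_def comp_def del: upt_Suc)
qed

text \<open>For \<open>s = Idx j\<close> with \<open>j \<le> k\<close> the symbol is repeated and
  the Pfaffian vanishes, leaving only the correction for odd \<open>k\<close>.\<close>

lemma lin_moment_Ppoly:
  assumes "tau \<rho> t (int k) \<noteq> 0" "j \<le> k"
  shows "lin (\<lambda>i. moment \<rho> t i j) (Ppoly \<rho> t (int k)) =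
    (if even k then 0 else - (tau \<rho> t (int k + 1) / tau \<rho> t (int k))) * single_moment \<rho> t j"
proof -
  have "Pf (entry \<rho> t) (pre k @ map Idx [0..<Suc k] @ [Idx j]) = 0"
  proof (rule Pf_not_distinct[OF entry_skew])
    show "even (length (pre k @ map Idx [0..<Suc k] @ [Idx j]))"
      by (simp add: length_pre del: upt_Suc)
    show "\<not> distinct (pre k @ map Idx [0..<Suc k] @ [Idx j])"
      using assms(2) by (auto simp del: upt_Suc)
  qed
  then show ?thesis
    using lin_Ppoly[OF assms(1), of "Idx j"] assms by (simp add: field_simps split: if_splits del: upt_Suc)
qed

text \<open>Here \<open>s = D0\<close>: for even \<open>k\<close> it moves to the front and produces
  \<open>\<tau>_{k+1}\<close>, for odd \<open>k\<close> it is repeated.\<close>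

lemma lin_single_moment_Ppoly:
  assumes "tau \<rho> t (int k) \<noteq> 0"
  shows "lin (single_moment \<rho> t) (Ppoly \<rho> t (int k)) =
    (if even k then tau \<rho> t (int k + 1) / tau \<rho> t (int k) else 0)"
proof -
  have "lin (\<lambda>i. (- 1) * single_moment \<rho> t i) (Ppoly \<rho> t (int k)) = - lin (single_moment \<rho> t) (Ppoly \<rho> t (int k))"
    unfolding lin_cmult_fun by simp
  then have eq: "- (tau \<rho> t (int k) * lin (single_moment \<rho> t) (Ppoly \<rho> t (int k))) =
      Pf (entry \<rho> t) (pre k @ map Idx [0..<Suc k] @ [D0])"
    using lin_Ppoly[OF assms, of D0] by (simp del: upt_Suc)
  show ?thesis
  proof (cases "even k")
    case True
    have "Pf (entry \<rho> t) ([] @ D0 # map Idx [0..<Suc k] @ []) =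
        (- 1) ^ length (map Idx [0..<Suc k]) * Pf (entry \<rho> t) ([] @ map Idx [0..<Suc k] @ D0 # [])"
      by (rule Pf_move[OF entry_skew]) (use True in \<open>simp del: upt_Suc\<close>)
    then have "Pf (entry \<rho> t) (map Idx [0..<Suc k] @ [D0]) = - tau \<rho> t (int k + 1)"
      using tau_eq[of \<rho> t "Suc k"] True by (simp add: pre_def add.commute del: upt_Suc)
    then show ?thesis using eq True assms by (simp add: pre_def field_simps del: upt_Suc)
  next
    case False
    have "Pf (entry \<rho> t) (pre k @ map Idx [0..<Suc k] @ [D0]) = 0"
      by (rule Pf_not_distinct[OF entry_skew]) (use False in \<open>auto simp: pre_def simp del: upt_Suc\<close>)
    then show ?thesis using eq False assms by simp
  qed
qed

end

subsection \<open>The derivative of the tau function\<close>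

text \<open>
  Differentiating an entry raises one of its indices by one.  The symbol \<open>d\<^sub>0\<close> has no successor;
  \<open>None\<close> serves as one, with vanishing entries.
\<close>

fun entry0 :: "(real \<Rightarrow> real) \<Rightarrow> real \<Rightarrow> symbol option \<Rightarrow> symbol option \<Rightarrow> real" where
  "entry0 \<rho> t (Some a) (Some b) = entry \<rho> t a b"
| "entry0 \<rho> t None _ = 0"
| "entry0 \<rho> t _ None = 0"

lemma entry0_None [simp]: "entry0 \<rho> t a None = 0"
  by (cases a) auto

fun shift :: "symbol option \<Rightarrow> symbol option" where
  "shift (Some (Idx i)) = Some (Idx (Suc i))"
| "shift _ = None"

text \<open>Raising an index \<open>i < k\<close> duplicates \<open>i + 1\<close>, and raising
  \<open>D0\<close> creates a zero row. Only the last index survives, and the list with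
  \<open>k\<close> skipped is the one in the cofactor.\<close>

lemma deriv_tau:
  assumes skew: "\<And>i j. moment \<rho> t i j = - moment \<rho> t j i"
    and moment: "\<And>i j. ((\<lambda>s. moment \<rho> s i j) has_real_derivative
       moment \<rho> t (Suc i) j + moment \<rho> t i (Suc j)) (at t)"
    and single_moment: "\<And>i. ((\<lambda>s. single_moment \<rho> s i) has_real_derivative single_moment \<rho> t (Suc i)) (at t)"
  shows "deriv (\<lambda>s. tau \<rho> s (int (Suc k))) t = - cofac \<rho> t (Suc k) k"
proof -
  let ?m = "Suc k mod 2"
  let ?L = "map Some (pre (Suc k) @ map Idx [0..<Suc k])"
  have e: "((\<lambda>s. entry0 \<rho> s a b) has_real_derivative entry0 \<rho> t (shift a) b + entry0 \<rho> t a (shift b)) (at t)"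
    for a b
  proof (cases a; cases b)
    fix x y assume "a = Some x" "b = Some y"
    then show ?thesis
      using moment DERIV_minus[OF single_moment] single_moment
      by (cases x; cases y) auto
  qed auto
  have skew0: "entry0 \<rho> t a b = - entry0 \<rho> t b a" for a b
    by (cases a; cases b) (auto intro: entry_skew[OF skew])
  have tau: "tau \<rho> s (int (Suc k)) = Pf (entry0 \<rho> s) ?L" for s
    unfolding tau_eq Pf_map by simp
  have len: "even (length ?L)"
    by (simp add: length_pre del: upt_Suc)
  have L: "length ?L = Suc (?m + k)"
    by (simp add: length_pre)
  have nth: "?L ! (?m + i) = Some (Idx i)" if "i \<le> k" for i
    using that by (simp add: nth_append length_pre del: upt_Suc)
  have zero: "Pf (entry0 \<rho> t) (?L[p := shift (?L ! p)]) = 0" if p: "p < ?m + k" for p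
  proof (cases "p < ?m")
    case True
    then have "pre (Suc k) = [D0]" "p = 0"
      by (cases "even k"; simp add: pre_def)+
    then show ?thesis
      by (intro Pf_zero_row[OF skew0, where a = None]) (use len in auto)
  next
    case False
    then obtain i where i: "p = ?m + i" "i < k" using p by (metis add_less_cancel_left le_Suc_ex not_less)
    have "?L[p := shift (?L ! p)] ! p = ?L[p := shift (?L ! p)] ! Suc p"
      using i nth[of i] nth[of "Suc i"] L by simp
    then have "\<not> distinct (?L[p := shift (?L ! p)])"
      using nth_eq_iff_index_eq[of "?L[p := shift (?L ! p)]" p "Suc p"] p L by (metis length_list_update n_not_Suc_n less_SucI Suc_less_eq)
    then show ?thesis
      by (intro Pf_not_distinct[OF skew0]) (use len in auto)
  qed
  have "((\<lambda>s. tau \<rho> s (int (Suc k))) has_real_derivative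
      (\<Sum>p<Suc (?m + k). Pf (entry0 \<rho> t) (?L[p := shift (?L ! p)]))) (at t)"
    using has_real_derivative_Pf[of "entry0 \<rho>" t shift, OF e len] unfolding tau L .
  then have "deriv (\<lambda>s. tau \<rho> s (int (Suc k))) t = Pf (entry0 \<rho> t) (?L[?m + k := shift (?L ! (?m + k))])"
    using zero by (simp add: DERIV_imp_deriv)
  also have "?L[?m + k := shift (?L ! (?m + k))] = map Some (pre (Suc k) @ map Idx ([0..<k] @ [Suc k]))"
    unfolding nth[OF order_refl] by (simp add: list_update_append length_pre)
  also have "[0..<k] @ [Suc k] = del k [0..<Suc (Suc k)]"
    by (simp add: del_def)
  also have "Pf (entry0 \<rho> t) (map Some (pre (Suc k) @ map Idx (del k [0..<Suc (Suc k)]))) = - cofac \<rho> t (Suc k) k"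
    unfolding Pf_map cofac_def by (simp add: mod_2_eq_odd del: upt_Suc)
  finally show ?thesis .
qed

subsection \<open>Analytic properties of the moments\<close>

text \<open>A second-order remainder bound, obtained from \<open>1 + y \<le> exp y\<close>
  alone.\<close>

lemma abs_exp_minus_one_minus_self_le: "\<bar>exp y - 1 - y\<bar> \<le> y\<^sup>2 * exp \<bar>y\<bar>" for y :: real
proof -
  have *: "exp y - 1 \<le> y * exp y"
  proof -
    have "exp y * (1 - y) \<le> exp y * exp (- y)"
      using exp_ge_add_one_self[of "- y"] by (intro mult_left_mono) auto
    then show ?thesis by (simp add: exp_minus_inverse algebra_simps)
  qed
  have "exp y - 1 - y \<le> y * (exp y - 1)"
    using * by (simp add: algebra_simps)
  also have "\<dots> \<le> y\<^sup>2 * exp \<bar>y\<bar>"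
  proof (cases "y \<ge> 0")
    case True
    then show ?thesis using mult_left_mono[OF * True] by (simp add: power2_eq_square mult.assoc)
  next
    case False
    have "y \<le> exp y - 1"
      using exp_ge_add_one_self[of y] by linarith
    then have "y * (exp y - 1) \<le> y * y"
      using False by (intro mult_left_mono_neg) auto
    also have "\<dots> \<le> y\<^sup>2 * exp \<bar>y\<bar>"
      using mult_left_mono[of 1 "exp \<bar>y\<bar>" "y\<^sup>2"] by (simp add: power2_eq_square)
    finally show ?thesis .
  qed
  finally have "exp y - 1 - y \<le> y\<^sup>2 * exp \<bar>y\<bar>" .
  moreover have "0 \<le> exp y - 1 - y"
    using exp_ge_add_one_self[of y] by linarith
  ultimately show ?thesis by simp
qed

lemma DERIV_if_quadratic_error:
  fixes f :: "real \<Rightarrow> real"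
  assumes "d > 0" "\<And>h. \<bar>h\<bar> \<le> d \<Longrightarrow> \<bar>f (t + h) - f t - h * D\<bar> \<le> K * h\<^sup>2"
  shows "(f has_real_derivative D) (at t)"
  unfolding DERIV_def
proof (rule LIM_zero_cancel, rule Lim_null_comparison)
  show "((\<lambda>h. K * \<bar>h\<bar>) \<longlongrightarrow> 0) (at 0)"
    by (auto intro!: tendsto_eq_intros)
  have "\<forall>\<^sub>F h in at (0::real). \<bar>h\<bar> < d \<and> h \<noteq> 0"
    using assms(1) by (auto simp: eventually_at dist_real_def intro!: exI[of _ d])
  then show "\<forall>\<^sub>F h in at 0. norm ((f (t + h) - f t) / h - D) \<le> K * \<bar>h\<bar>"
  proof eventually_elim
    case (elim h)
    have "\<bar>f (t + h) - f t - h * D\<bar> \<le> (K * \<bar>h\<bar>) * \<bar>h\<bar>"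
      using assms(2)[of h] elim by (simp add: power2_eq_square mult.assoc)
    moreover have "norm ((f (t + h) - f t) / h - D) = \<bar>f (t + h) - f t - h * D\<bar> / \<bar>h\<bar>"
      using elim by (simp add: field_simps flip: abs_divide)
    ultimately show ?case using elim by (simp add: divide_le_eq)
  qed
qed

text \<open>The remainder is bounded quadratically in \<open>h\<close>. Since
  \<open>\<phi> \<ge> 0\<close> wherever \<open>w\<close> is nonzero,
  \<open>exp \<bar>h * \<phi> x\<bar>\<close> is at most \<open>exp (d * \<phi> x)\<close>, so one
  integrable function at the endpoint \<open>t + d\<close> dominates for all
  \<open>h\<close>.\<close>

lemma has_real_derivative_exp_integral:
  fixes \<phi> w :: "'a \<Rightarrow> real"
  assumes "d > 0" and \<phi>: "\<And>x. w x \<noteq> 0 \<Longrightarrow> \<phi> x \<ge> 0"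
    and int0: "\<And>s. \<bar>s - t\<bar> \<le> d \<Longrightarrow> integrable M (\<lambda>x. w x * exp (s * \<phi> x))"
    and int1: "integrable M (\<lambda>x. \<phi> x * w x * exp (t * \<phi> x))"
    and int2: "integrable M (\<lambda>x. (\<phi> x)\<^sup>2 * w x * exp ((t + d) * \<phi> x))"
  shows "((\<lambda>s. \<integral>x. w x * exp (s * \<phi> x) \<partial>M) has_real_derivative
           (\<integral>x. \<phi> x * w x * exp (t * \<phi> x) \<partial>M)) (at t)"
proof (rule DERIV_if_quadratic_error[OF assms(1)])
  fix h :: real
  assume h: "\<bar>h\<bar> \<le> d"
  let ?r = "\<lambda>x. w x * exp ((t + h) * \<phi> x) - w x * exp (t * \<phi> x) - h * (\<phi> x * w x * exp (t * \<phi> x))"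
  have int: "integrable M (\<lambda>x. w x * exp ((t + h) * \<phi> x))" "integrable M (\<lambda>x. w x * exp (t * \<phi> x))"
    using h assms(1) by (auto intro!: int0)
  have "\<bar>?r x\<bar> \<le> h\<^sup>2 * \<bar>(\<phi> x)\<^sup>2 * w x * exp ((t + d) * \<phi> x)\<bar>" for x
  proof (cases "w x = 0")
    case False
    then have "\<phi> x \<ge> 0" by (rule \<phi>)
    have "?r x = w x * exp (t * \<phi> x) * (exp (h * \<phi> x) - 1 - h * \<phi> x)"
      by (simp add: algebra_simps exp_add)
    then have "\<bar>?r x\<bar> = \<bar>w x\<bar> * exp (t * \<phi> x) * \<bar>exp (h * \<phi> x) - 1 - h * \<phi> x\<bar>"
      by (simp add: abs_mult)
    also have "\<dots> \<le> \<bar>w x\<bar> * exp (t * \<phi> x) * ((h * \<phi> x)\<^sup>2 * exp (d * \<phi> x))"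
    proof (intro mult_left_mono order_trans[OF abs_exp_minus_one_minus_self_le])
      show "exp \<bar>h * \<phi> x\<bar> \<le> exp (d * \<phi> x)"
        using h \<open>\<phi> x \<ge> 0\<close> by (simp add: abs_mult mult_right_mono)
    qed auto
    also have "\<dots> = h\<^sup>2 * \<bar>(\<phi> x)\<^sup>2 * w x * exp ((t + d) * \<phi> x)\<bar>"
      by (simp add: abs_mult power_mult_distrib distrib_right exp_add)
    finally show ?thesis .
  qed simp
  then have "(\<integral>x. \<bar>?r x\<bar> \<partial>M) \<le> (\<integral>x. h\<^sup>2 * \<bar>(\<phi> x)\<^sup>2 * w x * exp ((t + d) * \<phi> x)\<bar> \<partial>M)"
    using int int1 int2 by (intro integral_mono) auto
  also have "\<dots> = (\<integral>x. \<bar>(\<phi> x)\<^sup>2 * w x * exp ((t + d) * \<phi> x)\<bar> \<partial>M) * h\<^sup>2"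
    by simp
  finally have "(\<integral>x. \<bar>?r x\<bar> \<partial>M) \<le> (\<integral>x. \<bar>(\<phi> x)\<^sup>2 * w x * exp ((t + d) * \<phi> x)\<bar> \<partial>M) * h\<^sup>2" .
  moreover have "\<bar>\<integral>x. ?r x \<partial>M\<bar> \<le> (\<integral>x. \<bar>?r x\<bar> \<partial>M)"
    by (rule integral_abs_bound)
  moreover have "(\<integral>x. ?r x \<partial>M) = (\<integral>x. w x * exp ((t + h) * \<phi> x) \<partial>M) -
      (\<integral>x. w x * exp (t * \<phi> x) \<partial>M) - h * (\<integral>x. \<phi> x * w x * exp (t * \<phi> x) \<partial>M)"
    using int int1 by simp
  ultimately show "\<bar>(\<integral>x. w x * exp ((t + h) * \<phi> x) \<partial>M) - (\<integral>x. w x * exp (t * \<phi> x) \<partial>M) -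
      h * (\<integral>x. \<phi> x * w x * exp (t * \<phi> x) \<partial>M)\<bar> \<le>
      (\<integral>x. \<bar>(\<phi> x)\<^sup>2 * w x * exp ((t + d) * \<phi> x)\<bar> \<partial>M) * h\<^sup>2"
    by linarith
qed

section \<open>Product measures and a Borel representative of the weight\<close>

lemma
  fixes u v :: "real \<Rightarrow> real"
  assumes u: "integrable lborel u" and v: "integrable lborel v"
  shows integrable_lborel_prod_mult: "integrable (lborel \<Otimes>\<^sub>M lborel) (\<lambda>p. u (fst p) * v (snd p))"
    and integral_lborel_prod_mult:
      "(\<integral>p. u (fst p) * v (snd p) \<partial>(lborel \<Otimes>\<^sub>M lborel)) = (\<integral>x. u x \<partial>lborel) * (\<integral>y. v y \<partial>lborel)"
proof -
  have [measurable]: "u \<in> borel_measurable lborel" "v \<in> borel_measurable lborel"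
    using u v by auto
  show int: "integrable (lborel \<Otimes>\<^sub>M lborel) (\<lambda>p. u (fst p) * v (snd p))"
    using u v by (intro lborel_pair.Fubini_integrable) (auto simp: abs_mult)
  show "(\<integral>p. u (fst p) * v (snd p) \<partial>(lborel \<Otimes>\<^sub>M lborel)) = (\<integral>x. u x \<partial>lborel) * (\<integral>y. v y \<partial>lborel)"
    using lborel_pair.integral_fst'[OF int] by simp
qed

text \<open>The exceptional set lies in the union of \<open>N \<times> UNIV\<close> and
  \<open>UNIV \<times> N\<close>, both null.\<close>

lemma AE_lborel_prod:
  assumes "AE x in lborel. P (x :: real)"
  shows "AE p in lborel \<Otimes>\<^sub>M lborel. P (fst p) \<and> P (snd (p :: real \<times> real))"
proof -
  obtain N where N: "{x. \<not> P x} \<subseteq> N" "N \<in> null_sets lborel"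
    using assms by (auto elim!: AE_E simp: null_sets_def)
  then have "N \<times> UNIV \<union> UNIV \<times> N \<in> null_sets (lborel \<Otimes>\<^sub>M lborel)"
    by (intro null_sets.Un) (auto simp: null_sets_def lborel.emeasure_pair_measure_Times)
  then show ?thesis
    by (rule AE_I') (use N in auto)
qed

text \<open>A Borel representative permits Fubini on the product of Borel measures; its vanishing
  off the positive half-line absorbs the indicator.\<close>

lemma ex_borel_weight:
  fixes \<rho> :: "real \<Rightarrow> real"
  assumes "(\<lambda>x. indicator {0<..} x * \<rho> x) \<in> borel_measurable lebesgue"
  obtains g where "g \<in> borel_measurable borel" "\<And>x. x \<le> 0 \<Longrightarrow> g x = 0"
    "AE x in lborel. indicator {0<..} x * \<rho> x = g x"
proof -
  obtain g where g: "g \<in> borel_measurable lborel" "AE x in lborel. indicator {0<..} x * \<rho> x = g x"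
    using completion_ex_borel_measurable_real[OF assms] by blast
  have "AE x in lborel. indicator {0<..} x * \<rho> x = indicator {0<..} x * g x"
    using g(2) by eventually_elim (auto simp: indicator_def)
  then show thesis
    using g(1) by (intro that[of "\<lambda>x. indicator {0<..} x * g x"]) auto
qed

text \<open>The integrand without its exponential, so that the moments have the form
  \<open>w * exp (s * \<phi>)\<close> with \<open>\<phi> = x + y\<close>.\<close>

definition pair_weight :: "(real \<Rightarrow> real) \<Rightarrow> nat \<Rightarrow> nat \<Rightarrow> real \<times> real \<Rightarrow> real" where
  "pair_weight g i j p = fst p ^ i * snd p ^ j * ((fst p - snd p) / (fst p + snd p)) * (g (fst p) * g (snd p))"

context
  fixes g \<rho> :: "real \<Rightarrow> real"
  assumes g_borel [measurable]: "g \<in> borel_measurable borel"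
    and g_zero: "\<And>x. x \<le> 0 \<Longrightarrow> g x = 0"
    and g_AE: "AE x in lborel. indicator {0<..} x * \<rho> x = g x"
begin

lemma single_moment_AE:
  "AE x in lborel. indicator {0<..} x *\<^sub>R (x ^ i * exp (s * x) * \<rho> x) = x ^ i * g x * exp (s * x)"
  using g_AE
proof eventually_elim
  case (elim x)
  show ?case unfolding elim[symmetric] by (simp add: mult_ac)
qed

lemma single_moment_eq: "single_moment \<rho> s i = (\<integral>x. x ^ i * g x * exp (s * x) \<partial>lborel)"
proof -
  have meas: "(\<lambda>x. x ^ i * g x * exp (s * x)) \<in> borel_measurable lborel" by simp
  have AE: "AE x in lebesgue. x ^ i * g x * exp (s * x) = indicator {0<..} x *\<^sub>R (x ^ i * exp (s * x) * \<rho> x)"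
    using AE_completion[OF single_moment_AE[of i s]] by eventually_elim (rule sym)
  have "single_moment \<rho> s i = (\<integral>x. x ^ i * g x * exp (s * x) \<partial>lebesgue)"
    unfolding single_moment_def set_lebesgue_integral_def
    using AE measurable_completion[OF meas] borel_measurable_AE[OF measurable_completion[OF meas] AE]
    by (intro integral_cong_AE) auto
  then show ?thesis using integral_completion[OF meas] by simp
qed

lemma integrable_single_weight:
  assumes "set_integrable lebesgue {0<..} (\<lambda>x. x ^ i * exp (s * x) * \<rho> x)"
  shows "integrable lborel (\<lambda>x. x ^ i * g x * exp (s * x))"
proof -
  have meas: "(\<lambda>x. x ^ i * g x * exp (s * x)) \<in> borel_measurable lborel" by simp
  have "integrable lebesgue (\<lambda>x. x ^ i * g x * exp (s * x))"
    by (rule integrable_cong_AE_imp[OF assms[unfolded set_integrable_def] measurable_completion[OF meas]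
          AE_completion[OF single_moment_AE[of i s]]])
  then show ?thesis using integrable_completion[OF meas] by simp
qed

lemma pair_weight_measurable [measurable]: "pair_weight g i j \<in> borel_measurable (lborel \<Otimes>\<^sub>M lborel)"
  unfolding pair_weight_def by simp

lemma moment_eq:
  "moment \<rho> s i j = (\<integral>p. pair_weight g i j p * exp (s * (fst p + snd p)) \<partial>(lborel \<Otimes>\<^sub>M lborel))"
proof -
  let ?f = "\<lambda>p. pair_weight g i j p * exp (s * (fst p + snd p))"
  let ?h = "\<lambda>p. indicator ({0<..} \<times> {0<..}) p *\<^sub>R (fst p ^ i * snd p ^ j * ((fst p - snd p) / (fst p + snd p)) *
        exp (s * (fst p + snd p)) * \<rho> (fst p) * \<rho> (snd p))"
  have meas: "?f \<in> borel_measurable lborel" unfolding lborel_prod[symmetric] by simp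
  have "AE p in lborel. ?f p = ?h p"
    unfolding lborel_prod[symmetric] using AE_lborel_prod[OF g_AE]
  proof eventually_elim
    case (elim p)
    then show ?case
      by (cases p) (auto simp: pair_weight_def indicator_def split: if_splits)
  qed
  then have AE: "AE p in lebesgue. ?f p = ?h p" by (rule AE_completion)
  have "moment \<rho> s i j = (\<integral>p. ?f p \<partial>lebesgue)"
    unfolding moment_def set_lebesgue_integral_def
  proof (rule integral_cong_AE)
    show "?f \<in> borel_measurable lebesgue" by (rule measurable_completion[OF meas])
    then show "?h \<in> borel_measurable lebesgue" using AE by (rule borel_measurable_AE)
    show "AE p in lebesgue. ?h p = ?f p" using AE by eventually_elim simp
  qed
  then show ?thesis using integral_completion[OF meas] by (simp add: lborel_prod)
qed

text \<open>Exchanging the variables changes the sign of the kernel.\<close>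

lemma moment_skew: "moment \<rho> s i j = - moment \<rho> s j i"
proof -
  let ?f = "\<lambda>p. pair_weight g i j p * exp (s * (fst p + snd p))"
  have "pair_weight g i j (y, x) = - pair_weight g j i (x, y)" for x y
  proof -
    have "(y - x) / (y + x) = - ((x - y) / (x + y))"
      by (metis add.commute minus_diff_eq minus_divide_left)
    then show ?thesis by (simp add: pair_weight_def mult_ac)
  qed
  then have "(\<integral>(x, y). ?f (y, x) \<partial>(lborel \<Otimes>\<^sub>M lborel)) =
      (\<integral>p. - (pair_weight g j i p * exp (s * (fst p + snd p))) \<partial>(lborel \<Otimes>\<^sub>M lborel))"
    by (intro Bochner_Integration.integral_cong) (auto simp: add.commute)
  moreover have "(\<integral>(x, y). ?f (y, x) \<partial>(lborel \<Otimes>\<^sub>M lborel)) = (\<integral>p. ?f p \<partial>(lborel \<Otimes>\<^sub>M lborel))"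
    by (rule lborel_pair.integral_product_swap) simp
  ultimately show ?thesis by (simp add: moment_eq)
qed

text \<open>The kernel is at most 1 in absolute value on the open quadrant and \<open>g\<close>
  vanishes elsewhere, so a product of one-variable integrands dominates.\<close>

lemma integrable_pair_weight:
  assumes "\<And>i. integrable lborel (\<lambda>x. x ^ i * g x * exp (s * x))"
  shows "integrable (lborel \<Otimes>\<^sub>M lborel) (\<lambda>p. pair_weight g i j p * exp (s * (fst p + snd p)))"
proof (rule Bochner_Integration.integrable_bound)
  show "integrable (lborel \<Otimes>\<^sub>M lborel)
      (\<lambda>p. (fst p ^ i * g (fst p) * exp (s * fst p)) * (snd p ^ j * g (snd p) * exp (s * snd p)))"
    by (intro integrable_lborel_prod_mult assms)
  have "norm (pair_weight g i j p * exp (s * (fst p + snd p))) \<le>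
      norm ((fst p ^ i * g (fst p) * exp (s * fst p)) * (snd p ^ j * g (snd p) * exp (s * snd p)))" for p
  proof (cases "fst p > 0 \<and> snd p > 0")
    case True
    then have "\<bar>(fst p - snd p) / (fst p + snd p)\<bar> \<le> 1" by (auto simp: abs_le_iff field_simps)
    then have "\<bar>(fst p - snd p) / (fst p + snd p)\<bar> *
        norm ((fst p ^ i * g (fst p) * exp (s * fst p)) * (snd p ^ j * g (snd p) * exp (s * snd p))) \<le>
        1 * norm ((fst p ^ i * g (fst p) * exp (s * fst p)) * (snd p ^ j * g (snd p) * exp (s * snd p)))"
      by (intro mult_right_mono) auto
    moreover have "norm (pair_weight g i j p * exp (s * (fst p + snd p))) = \<bar>(fst p - snd p) / (fst p + snd p)\<bar> *
        norm ((fst p ^ i * g (fst p) * exp (s * fst p)) * (snd p ^ j * g (snd p) * exp (s * snd p)))"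
      by (simp add: pair_weight_def norm_mult abs_mult distrib_left exp_add)
    ultimately show ?thesis by simp
  next
    case False
    then have "pair_weight g i j p = 0"
      using g_zero[of "fst p"] g_zero[of "snd p"] by (auto simp: pair_weight_def)
    then show ?thesis by simp
  qed
  then show "AE p in lborel \<Otimes>\<^sub>M lborel. norm (pair_weight g i j p * exp (s * (fst p + snd p))) \<le>
      norm ((fst p ^ i * g (fst p) * exp (s * fst p)) * (snd p ^ j * g (snd p) * exp (s * snd p)))"
    by simp
qed simp

lemma pair_weight_add:
  "(fst p + snd p) * pair_weight g i j p = pair_weight g (Suc i) j p + pair_weight g i (Suc j) p"
proof -
  have "(a + b) * (a ^ i * b ^ j * r * w) = a ^ Suc i * b ^ j * r * w + a ^ i * b ^ Suc j * r * w" for a b r w :: real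
    by (simp add: algebra_simps)
  then show ?thesis unfolding pair_weight_def .
qed

lemma pair_weight_nonzero: "pair_weight g i j p \<noteq> 0 \<Longrightarrow> fst p + snd p \<ge> 0"
  using g_zero[of "fst p"] g_zero[of "snd p"] by (cases "fst p > 0 \<and> snd p > 0") (auto simp: pair_weight_def)

text \<open>The sum of the two integrands carries the factor \<open>x + y\<close>, which cancels the
  denominator; what remains separates into products.\<close>

lemma moment_add:
  assumes "\<And>i. integrable lborel (\<lambda>x. x ^ i * g x * exp (s * x))"
  shows "moment \<rho> s (Suc i) j + moment \<rho> s i (Suc j) =
    single_moment \<rho> s (Suc i) * single_moment \<rho> s j - single_moment \<rho> s i * single_moment \<rho> s (Suc j)"
proof -
  let ?u = "\<lambda>i x. x ^ i * g x * exp (s * x)"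
  have *: "pair_weight g (Suc i) j p * exp (s * (fst p + snd p)) + pair_weight g i (Suc j) p * exp (s * (fst p + snd p)) =
     ?u (Suc i) (fst p) * ?u j (snd p) - ?u i (fst p) * ?u (Suc j) (snd p)" for p
  proof (cases "fst p > 0 \<and> snd p > 0")
    case True
    then have "(fst p + snd p) * pair_weight g i j p = fst p ^ i * snd p ^ j * (fst p - snd p) * (g (fst p) * g (snd p))"
      by (simp add: pair_weight_def)
    note eq = this
    show ?thesis
      unfolding distrib_right[symmetric] pair_weight_add[symmetric] eq
      by (simp add: exp_add algebra_simps)
  next
    case False
    then show ?thesis
      using g_zero[of "fst p"] g_zero[of "snd p"] by (auto simp: pair_weight_def)
  qed
  have "moment \<rho> s (Suc i) j + moment \<rho> s i (Suc j) =
      (\<integral>p. ?u (Suc i) (fst p) * ?u j (snd p) - ?u i (fst p) * ?u (Suc j) (snd p) \<partial>(lborel \<Otimes>\<^sub>M lborel))"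
    unfolding moment_eq *[symmetric]
    by (intro Bochner_Integration.integral_add[symmetric] integrable_pair_weight assms)
  also have "\<dots> = single_moment \<rho> s (Suc i) * single_moment \<rho> s j - single_moment \<rho> s i * single_moment \<rho> s (Suc j)"
    unfolding single_moment_eq integral_lborel_prod_mult[OF assms assms, symmetric]
    by (intro Bochner_Integration.integral_diff integrable_lborel_prod_mult assms)
  finally show ?thesis .
qed

text \<open>The factors \<open>x\<close> and \<open>x + y\<close> brought down by differentiation
  only raise exponents, so integrability for all exponents meets every condition of the general
  rule.\<close>

lemma
  assumes "d > 0" and int: "\<And>s i. \<bar>s - t\<bar> \<le> d \<Longrightarrow> integrable lborel (\<lambda>x. x ^ i * g x * exp (s * x))"
  shows has_real_derivative_single_moment:
      "((\<lambda>s. single_moment \<rho> s i) has_real_derivative single_moment \<rho> t (Suc i)) (at t)"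
    and has_real_derivative_moment:
      "((\<lambda>s. moment \<rho> s i j) has_real_derivative moment \<rho> t (Suc i) j + moment \<rho> t i (Suc j)) (at t)"
proof -
  have int1: "\<And>i. integrable lborel (\<lambda>x. x ^ i * g x * exp (t * x))"
    and int2: "\<And>i. integrable lborel (\<lambda>x. x ^ i * g x * exp ((t + d) * x))"
    using assms by (auto intro!: int)
  have "((\<lambda>s. \<integral>x. (x ^ i * g x) * exp (s * x) \<partial>lborel) has_real_derivative
      (\<integral>x. x * (x ^ i * g x) * exp (t * x) \<partial>lborel)) (at t)"
  proof (rule has_real_derivative_exp_integral[OF \<open>d > 0\<close>])
    show "x \<ge> 0" if "x ^ i * g x \<noteq> 0" for x
      using that g_zero[of x] by (cases "x \<le> 0") auto
    show "integrable lborel (\<lambda>x. x * (x ^ i * g x) * exp (t * x))"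
      using int1[of "Suc i"] by (simp add: mult.assoc)
    show "integrable lborel (\<lambda>x. x\<^sup>2 * (x ^ i * g x) * exp ((t + d) * x))"
      using int2[of "Suc (Suc i)"] by (simp add: power2_eq_square mult.assoc)
  qed (rule int)
  then show "((\<lambda>s. single_moment \<rho> s i) has_real_derivative single_moment \<rho> t (Suc i)) (at t)"
    by (simp add: single_moment_eq mult.assoc)
  have "((\<lambda>s. \<integral>p. pair_weight g i j p * exp (s * (fst p + snd p)) \<partial>(lborel \<Otimes>\<^sub>M lborel)) has_real_derivative
      (\<integral>p. (fst p + snd p) * pair_weight g i j p * exp (t * (fst p + snd p)) \<partial>(lborel \<Otimes>\<^sub>M lborel))) (at t)"
  proof (rule has_real_derivative_exp_integral[OF \<open>d > 0\<close>])
    show "fst p + snd p \<ge> 0" if "pair_weight g i j p \<noteq> 0" for p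
      using that by (rule pair_weight_nonzero)
    show "integrable (lborel \<Otimes>\<^sub>M lborel) (\<lambda>p. pair_weight g i j p * exp (s * (fst p + snd p)))"
      if "\<bar>s - t\<bar> \<le> d" for s
      using that by (intro integrable_pair_weight int)
    show "integrable (lborel \<Otimes>\<^sub>M lborel) (\<lambda>p. (fst p + snd p) * pair_weight g i j p * exp (t * (fst p + snd p)))"
      unfolding pair_weight_add distrib_right[of _ _ "exp _"]
      by (intro Bochner_Integration.integrable_add integrable_pair_weight int1)
    have "(fst p + snd p)\<^sup>2 * pair_weight g i j p = (pair_weight g (Suc (Suc i)) j p + pair_weight g (Suc i) (Suc j) p) +
        (pair_weight g (Suc i) (Suc j) p + pair_weight g i (Suc (Suc j)) p)" for p
      unfolding power2_eq_square mult.assoc pair_weight_add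
      by (simp only: distrib_left pair_weight_add)
    then show "integrable (lborel \<Otimes>\<^sub>M lborel) (\<lambda>p. (fst p + snd p)\<^sup>2 * pair_weight g i j p * exp ((t + d) * (fst p + snd p)))"
      by (simp only: distrib_right[of _ _ "exp _"])
        (intro Bochner_Integration.integrable_add integrable_pair_weight int2)
  qed
  also have "(\<integral>p. (fst p + snd p) * pair_weight g i j p * exp (t * (fst p + snd p)) \<partial>(lborel \<Otimes>\<^sub>M lborel)) =
      moment \<rho> t (Suc i) j + moment \<rho> t i (Suc j)"
    unfolding pair_weight_add distrib_right[of _ _ "exp _"] moment_eq
    by (intro Bochner_Integration.integral_add integrable_pair_weight int1)
  finally show "((\<lambda>s. moment \<rho> s i j) has_real_derivative moment \<rho> t (Suc i) j + moment \<rho> t i (Suc j)) (at t)"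
    by (simp only: moment_eq)
qed

end

subsection \<open>The four-term recurrence\<close>

text \<open>The facts about moments and polynomials from which the recurrence follows algebraically;
  \<open>h k\<close> stands for \<open>\<tau>_{k+1} / \<tau>_k\<close>.\<close>

locale partial_skew_orthogonal =
  fixes \<mu> :: "nat \<Rightarrow> nat \<Rightarrow> real" and \<beta> :: "nat \<Rightarrow> real" and P :: "nat \<Rightarrow> real poly" and h :: "nat \<Rightarrow> real"
  assumes h_nonzero: "h k \<noteq> 0"
    and \<mu>_skew: "\<mu> i j = - \<mu> j i"
    and \<mu>_add: "\<mu> (Suc i) j + \<mu> i (Suc j) = \<beta> (Suc i) * \<beta> j - \<beta> i * \<beta> (Suc j)"
    and degree_P: "degree (P k) \<le> k"
    and coeff_P: "coeff (P k) k = 1"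
    and lin_\<mu>_P: "j \<le> k \<Longrightarrow> lin (\<lambda>i. \<mu> i j) (P k) = (if even k then 0 else - h k) * \<beta> j"
    and lin_\<beta>_P: "lin \<beta> (P k) = (if even k then h k else 0)"
begin

definition form :: "real poly \<Rightarrow> real poly \<Rightarrow> real" where
  "form p q = lin (\<lambda>j. lin (\<lambda>i. \<mu> i j) p) q"

lemma form_skew: "form p q = - form q p"
proof -
  have "form p q = lin (\<lambda>j. (- 1) * lin (\<lambda>i. \<mu> j i) p) q"
    unfolding form_def lin_cmult_fun[symmetric] by (subst \<mu>_skew) simp
  also have "\<dots> = - form q p"
    unfolding lin_cmult_fun form_def by (subst lin_swap) simp
  finally show ?thesis .
qed

lemma form_right: "form p (q + r) = form p q + form p r" "form p (q - r) = form p q - form p r"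
  "form p (smult c q) = c * form p q"
  by (simp_all add: form_def lin_add lin_diff lin_smult)

lemma form_left: "form (p + q) r = form p r + form q r" "form (p - q) r = form p r - form q r"
  "form (smult c p) r = c * form p r"
  by (simp_all add: form_skew[of _ r] form_right)

lemma form_pCons:
  "form (pCons 0 p) q + form p (pCons 0 q) = lin \<beta> (pCons 0 p) * lin \<beta> q - lin \<beta> p * lin \<beta> (pCons 0 q)"
proof -
  have "form (pCons 0 p) q + form p (pCons 0 q) =
      lin (\<lambda>j. lin (\<lambda>i. \<beta> j * \<beta> (Suc i) - \<beta> (Suc j) * \<beta> i) p) q"
    unfolding form_def lin_pCons_0 lin_add_fun[symmetric] \<mu>_add by (simp add: mult.commute)
  also have "(\<lambda>j. lin (\<lambda>i. \<beta> j * \<beta> (Suc i) - \<beta> (Suc j) * \<beta> i) p) =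
      (\<lambda>j. lin (\<lambda>i. \<beta> (Suc i)) p * \<beta> j - lin \<beta> p * \<beta> (Suc j))"
    by (intro ext trans[OF lin_comb_fun]) (simp only: mult.commute)
  also have "lin \<dots> q = lin (\<lambda>i. \<beta> (Suc i)) p * lin \<beta> q - lin \<beta> p * lin (\<lambda>j. \<beta> (Suc j)) q"
    by (rule lin_comb_fun)
  finally show ?thesis by (simp add: lin_pCons_0)
qed

definition c :: "nat \<Rightarrow> real" where
  "c k = (if even k then 0 else - h k)"

lemma form_P:
  assumes "degree f \<le> k"
  shows "form (P k) f = c k * lin \<beta> f"
proof -
  have "form (P k) f = (\<Sum>j\<le>k. coeff f j * (c k * \<beta> j))"
    unfolding form_def lin_altdef[OF assms] by (intro sum.cong) (simp_all add: lin_\<mu>_P c_def)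
  then show ?thesis
    unfolding lin_altdef[OF assms] by (simp add: sum_distrib_left mult_ac)
qed

lemma degree_diff_P:
  assumes "degree f \<le> Suc k"
  shows "degree (f - smult (coeff f (Suc k)) (P (Suc k))) \<le> k"
proof (rule degree_le, intro allI impI)
  fix i assume "k < i"
  then consider "i = Suc k" | "i > Suc k" by linarith
  then show "coeff (f - smult (coeff f (Suc k)) (P (Suc k))) i = 0"
    using degree_P[of "Suc k"] assms by cases (auto simp: coeff_P coeff_eq_0)
qed

text \<open>Split off the multiple of \<open>P (Suc k)\<close>. The product
  \<open>h (Suc k) * h k\<close> arises for even \<open>k\<close> from pairing \<open>P k\<close>
  with \<open>P (Suc k)\<close>, for odd \<open>k\<close> from
  \<open>lin \<beta> (P (Suc k))\<close>.\<close>

lemma form_P_Suc: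
  assumes "degree f \<le> Suc k"
  shows "form (P k) f = coeff f (Suc k) * (h (Suc k) * h k) + c k * lin \<beta> f"
proof -
  define r where "r = f - smult (coeff f (Suc k)) (P (Suc k))"
  have "form (P k) r = c k * lin \<beta> r"
    unfolding r_def by (intro form_P degree_diff_P assms)
  moreover have "form (P k) (P (Suc k)) = - (c (Suc k) * lin \<beta> (P k))"
    using form_P[of "P k" "Suc k"] degree_P[of k] form_skew[of "P k" "P (Suc k)"] by simp
  ultimately show ?thesis
    by (cases "even k") (simp_all add: r_def form_right lin_diff lin_smult lin_\<beta>_P c_def algebra_simps)
qed

text \<open>The skew form alone is degenerate in odd dimension; \<open>lin \<beta> p = 0\<close>
  compensates. Evaluating \<open>form r (P m)\<close> in two ways shows that the leading coefficient
  \<open>a\<close> vanishes, whatever the parity of \<open>m\<close>.\<close>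

lemma form_nondegenerate:
  assumes "degree p \<le> m" "lin \<beta> p = 0" "\<And>f. degree f \<le> m \<Longrightarrow> form p f = 0"
  shows "p = 0"
  using assms
proof (induction m arbitrary: p)
  case 0
  have const: "q = [:coeff q 0:]" if "degree q \<le> 0" for q :: "real poly"
    using that by (metis degree_0_id le_zero_eq)
  have "P 0 = [:1:]"
    using const[OF degree_P[of 0]] coeff_P[of 0] by simp
  then have "p = smult (coeff p 0) (P 0)"
    using const[OF "0.prems"(1)] by simp
  then have "lin \<beta> p = coeff p 0 * h 0"
    using lin_smult[of \<beta> "coeff p 0" "P 0"] lin_\<beta>_P[of 0] by simp
  then show ?case using "0.prems"(2) h_nonzero[of 0] \<open>p = smult _ _\<close> by simp
next
  case (Suc m)
  define a where "a = coeff p (Suc m)"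
  define r where "r = p - smult a (P (Suc m))"
  have r: "degree r \<le> m"
    unfolding r_def a_def by (intro degree_diff_P Suc.prems)
  have "form r (P m) = - (a * (c (Suc m) * lin \<beta> (P m)))"
    unfolding r_def form_left using Suc.prems(3)[of "P m"] form_P[of "P m" "Suc m"] degree_P[of m] by simp
  moreover have "form r (P m) = - (c m * lin \<beta> r)"
    using form_P[OF r] form_skew[of r "P m"] by simp
  moreover have "lin \<beta> r = - (a * lin \<beta> (P (Suc m)))"
    unfolding r_def using Suc.prems(2) by (simp add: lin_diff lin_smult)
  ultimately have "a = 0"
    using h_nonzero[of m] h_nonzero[of "Suc m"]
    by (cases "even m") (simp_all add: lin_\<beta>_P c_def)
  then have "r = p" by (simp add: r_def)
  then show ?case using r Suc.prems by (intro Suc.IH) auto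
qed

text \<open>Off by one: this is \<open>u_{k+1}\<close> of the recurrence, because
  \<open>u_0 = 0\<close> is not a quotient of values of \<open>h\<close>.\<close>

definition u :: "nat \<Rightarrow> real" where
  "u k = h (Suc k) / h k"

text \<open>
  The remainder \<open>r\<close> of the recurrence has degree at most \<open>m\<close>, and \<open>form r f = lin \<beta> r * lin \<beta> f\<close> for
  all \<open>f\<close> of degree at most \<open>m\<close>.  Taking \<open>f = r\<close> gives \<open>lin \<beta> r = 0\<close> because \<open>form\<close> is alternating.
  The term \<open>smult C q\<close> is the one with \<open>P\<^sub>n\<^sub>-\<^sub>2\<close>; it is kept abstract to include the case \<open>n = 1\<close>.
\<close>

lemma recurrence_general:
  assumes q: "degree q \<le> m"
    and C: "\<And>f. degree f \<le> m \<Longrightarrow>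
      C * (form q f - lin \<beta> q * lin \<beta> f) = - u m * h (Suc m) * (coeff f m * h m - lin \<beta> f)"
  defines "\<Delta> \<equiv> coeff (P (Suc m)) m - coeff (P (Suc (Suc m))) (Suc m)"
  shows "pCons 0 (P (Suc m) + smult (u m) (P m)) =
    P (Suc (Suc m)) + smult (\<Delta> + u m) (P (Suc m)) - smult (u m * (\<Delta> + u (Suc m))) (P m) + smult C q"
    (is "?Q = ?S")
proof -
  define r where "r = ?Q - ?S"
  have deg: "degree (P m) \<le> m" "degree (P (Suc m)) \<le> Suc m" "degree (P (Suc (Suc m))) \<le> Suc (Suc m)"
    by (rule degree_P)+
  \<comment> \<open>Degree \<open>m + 2\<close> cancels since the polynomials are monic, degree
    \<open>m + 1\<close> by the choice of \<open>\<Delta>\<close>.\<close>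
  have r: "degree r \<le> m"
  proof (rule degree_le, intro allI impI)
    fix i assume "m < i"
    then consider "i = Suc m" | "i = Suc (Suc m)" | j where "i = Suc j" "j > Suc m"
      by (metis Suc_lessI less_imp_Suc_add Suc_lessE)
    then show "coeff r i = 0"
      using deg q by cases (auto simp: r_def coeff_P coeff_eq_0 \<Delta>_def)
  qed
  have form_r: "form r f = lin \<beta> r * lin \<beta> f" if f: "degree f \<le> m" for f
  proof -
    let ?b = "lin \<beta>"
    have pf: "degree (pCons 0 f) \<le> Suc m"
      using f degree_pCons_le[of 0 f] by linarith
    have 1: "form (P (Suc m)) (pCons 0 f) = c (Suc m) * ?b (pCons 0 f)"
      by (rule form_P[OF pf])
    have 2: "form (P m) (pCons 0 f) = coeff f m * (h (Suc m) * h m) + c m * ?b (pCons 0 f)"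
      using form_P_Suc[OF pf] by simp
    \<comment> \<open>The coefficient of \<open>lin \<beta> (pCons 0 f)\<close>; the value of
      \<open>u m\<close> makes it vanish, which is why \<open>P_n + u_n P_{n-1}\<close> is the right
      combination.\<close>
    have cb: "c (Suc m) + ?b (P (Suc m)) + u m * (c m + ?b (P m)) = 0"
      using h_nonzero[of m] by (simp add: c_def lin_\<beta>_P u_def)
    have "form ?Q f = - form (P (Suc m) + smult (u m) (P m)) (pCons 0 f) + ?b ?Q * ?b f -
        ?b (P (Suc m) + smult (u m) (P m)) * ?b (pCons 0 f)"
      using form_pCons[of "P (Suc m) + smult (u m) (P m)" f] by linarith
    also have "\<dots> = - (u m * coeff f m * (h (Suc m) * h m)) + ?b ?Q * ?b f -
        (c (Suc m) + ?b (P (Suc m)) + u m * (c m + ?b (P m))) * ?b (pCons 0 f)"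
      by (simp add: form_left lin_add lin_smult 1 2 algebra_simps)
    finally have Q: "form ?Q f = - (u m * coeff f m * (h (Suc m) * h m)) + ?b ?Q * ?b f"
      by (simp add: cb)
    \<comment> \<open>This merges the two parities into one formula.\<close>
    have b: "?b (P k) = c k + h k" for k
      by (simp add: lin_\<beta>_P c_def)
    have P: "form (P m) f = c m * ?b f" "form (P (Suc m)) f = c (Suc m) * ?b f"
      "form (P (Suc (Suc m))) f = c (Suc (Suc m)) * ?b f"
      using f by (auto intro: form_P)
    have qf: "C * form q f = C * ?b q * ?b f - u m * h (Suc m) * (coeff f m * h m - ?b f)"
      using C[OF f] by (simp add: algebra_simps)
    have "form r f - ?b r * ?b f =
        (h (Suc (Suc m)) + (\<Delta> + u m) * h (Suc m) - u m * (\<Delta> + u (Suc m)) * h m - u m * h (Suc m)) * ?b f"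
      unfolding r_def form_left lin_add lin_diff lin_smult qf Q P b by (simp add: algebra_simps)
    also have "\<dots> = 0"
      using h_nonzero[of m] h_nonzero[of "Suc m"] by (simp add: u_def field_simps)
    finally show ?thesis by simp
  qed
  have "form r r = 0"
    using form_skew[of r r] by simp
  then have "lin \<beta> r = 0"
    using form_r[OF r] by simp
  then have "r = 0"
    using form_r r by (intro form_nondegenerate[of r m]) auto
  then show ?thesis by (simp add: r_def)
qed

text \<open>The cases \<open>n = m + 2\<close> and \<open>n = 1\<close>; \<open>\<Delta> m\<close>
  stands for \<open>b_{m+2} - b_{m+1}\<close>.\<close>

lemma recurrence:
  defines "\<Delta> \<equiv> \<lambda>m. coeff (P (Suc m)) m - coeff (P (Suc (Suc m))) (Suc m)"
  shows "pCons 0 (P (Suc (Suc m)) + smult (u (Suc m)) (P (Suc m))) =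
    P (Suc (Suc (Suc m))) + smult (\<Delta> (Suc m) + u (Suc m)) (P (Suc (Suc m))) -
    smult (u (Suc m) * (\<Delta> (Suc m) + u (Suc (Suc m)))) (P (Suc m)) - smult ((u (Suc m))\<^sup>2 * u m) (P m)"
    (is ?general)
  and "pCons 0 (P (Suc 0) + smult (u 0) (P 0)) =
    P (Suc (Suc 0)) + smult (\<Delta> 0 + u 0) (P (Suc 0)) - smult (u 0 * (\<Delta> 0 + u (Suc 0))) (P 0)"
    (is ?one)
proof -
  have "- ((u (Suc m))\<^sup>2 * u m) * (form (P m) f - lin \<beta> (P m) * lin \<beta> f) =
      - u (Suc m) * h (Suc (Suc m)) * (coeff f (Suc m) * h (Suc m) - lin \<beta> f)"
    if "degree f \<le> Suc m" for f
  proof -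
    have "form (P m) f - lin \<beta> (P m) * lin \<beta> f = h m * (coeff f (Suc m) * h (Suc m) - lin \<beta> f)"
      unfolding form_P_Suc[OF that] by (simp add: c_def lin_\<beta>_P algebra_simps)
    moreover have "(u (Suc m))\<^sup>2 * u m * h m = u (Suc m) * h (Suc (Suc m))"
      using h_nonzero[of m] h_nonzero[of "Suc m"] by (simp add: u_def power2_eq_square)
    ultimately show ?thesis by (metis (no_types, lifting) mult.assoc mult_minus_left)
  qed
  from recurrence_general[OF _ this] show ?general
    using le_SucI[OF degree_P[of m]] by (simp add: \<Delta>_def)
  \<comment> \<open>For \<open>n = 1\<close> there is no earlier polynomial: with
    \<open>q = 0\<close> the condition says that \<open>lin \<beta> f = coeff f 0 * h 0\<close> for
    constant \<open>f\<close>.\<close>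
  have "0 * (form 0 f - lin \<beta> 0 * lin \<beta> f) = - u 0 * h (Suc 0) * (coeff f 0 * h 0 - lin \<beta> f)"
    if "degree f \<le> 0" for f
  proof -
    have "\<beta> 0 = h 0"
      using lin_\<beta>_P[of 0] degree_P[of 0] coeff_P[of 0] by (simp add: lin_def)
    then show ?thesis using that by (simp add: lin_def)
  qed
  from recurrence_general[OF _ this] show ?one
    by (simp add: \<Delta>_def)
qed

end

theorem theorem3p24:
  fixes \<rho> :: "real \<Rightarrow> real" and I :: "real set" and t :: real and n :: int
  assumes pos: "\<And>x. x > 0 \<Longrightarrow> \<rho> x > 0"
    and interval: "open I" "is_interval I"
    and integrable: "\<And>i t. t \<in> I \<Longrightarrow> set_integrable lebesgue {0<..} (\<lambda>x. x ^ i * exp (t * x) * \<rho> x)"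
    and tau_nonzero: "\<And>k t. t \<in> I \<Longrightarrow> k \<ge> 0 \<Longrightarrow> tau \<rho> t k \<noteq> 0"
    and t: "t \<in> I"
    and n: "n \<ge> 0"
  shows "[:0, 1:] * (Ppoly \<rho> t n + smult (ucoef \<rho> t n) (Ppoly \<rho> t (n - 1))) =
           Ppoly \<rho> t (n + 1)
           + smult (bcoef \<rho> t (n + 1) - bcoef \<rho> t n + ucoef \<rho> t n) (Ppoly \<rho> t n)
           - smult (ucoef \<rho> t n * (bcoef \<rho> t (n + 1) - bcoef \<rho> t n + ucoef \<rho> t (n + 1))) (Ppoly \<rho> t (n - 1))
           - smult ((ucoef \<rho> t n)\<^sup>2 * ucoef \<rho> t (n - 1)) (Ppoly \<rho> t (n - 2))"
proof -
  \<comment> \<open>A closed neighbourhood, since integrability at the endpoint \<open>t + d\<close>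
    enters the differentiation.\<close>
  have open_I: "\<exists>d>0. \<forall>s. \<bar>s - t\<bar> \<le> d \<longrightarrow> s \<in> I"
    using open_contains_cball[THEN iffD1, OF interval(1)] t
    by (fastforce simp: dist_real_def abs_minus_commute subset_eq)
  then obtain d where d: "d > 0" "\<And>s. \<bar>s - t\<bar> \<le> d \<Longrightarrow> s \<in> I" by blast
  \<comment> \<open>Dividing the integrand for \<open>i = 0\<close> by its exponential shows that
    \<open>\<rho>\<close> is measurable on the half-line.\<close>
  have "(\<lambda>x. exp (- (t * x)) * (indicator {0<..} x *\<^sub>R (x ^ 0 * exp (t * x) * \<rho> x))) \<in> borel_measurable lebesgue"
  proof (rule borel_measurable_times)
    show "(\<lambda>x. exp (- (t * x))) \<in> borel_measurable lebesgue"
      by (rule measurable_completion) simp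
    show "(\<lambda>x. indicator {0<..} x *\<^sub>R (x ^ 0 * exp (t * x) * \<rho> x)) \<in> borel_measurable lebesgue"
      using integrable[OF t, of 0] unfolding set_integrable_def by (rule borel_measurable_integrable)
  qed
  also have "(\<lambda>x. exp (- (t * x)) * (indicator {0<..} x *\<^sub>R (x ^ 0 * exp (t * x) * \<rho> x))) =
      (\<lambda>x. indicator {0<..} x * \<rho> x)"
    by (auto simp: fun_eq_iff exp_minus)
  finally obtain g where g: "g \<in> borel_measurable borel" "\<And>x. x \<le> 0 \<Longrightarrow> g x = 0"
    "AE x in lborel. indicator {0<..} x * \<rho> x = g x"
    using ex_borel_weight by blast
  have int: "integrable lborel (\<lambda>x. x ^ i * g x * exp (s * x))" if "s \<in> I" for s i
    using g integrable[OF that] by (intro integrable_single_weight)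
  have skew: "moment \<rho> t i j = - moment \<rho> t j i" for i j
    by (rule moment_skew) (use g in auto)
  have deriv_single: "((\<lambda>s. single_moment \<rho> s i) has_real_derivative single_moment \<rho> t (Suc i)) (at t)" for i
    by (rule has_real_derivative_single_moment[OF g d(1)]) (use d int in auto)
  have deriv_moment: "((\<lambda>s. moment \<rho> s i j) has_real_derivative moment \<rho> t (Suc i) j + moment \<rho> t i (Suc j)) (at t)"
    for i j
    by (rule has_real_derivative_moment[OF g d(1)]) (use d int in auto)
  have tau: "tau \<rho> t (int k) \<noteq> 0" for k
    using tau_nonzero[OF t] by simp
  define P where "P k = Ppoly \<rho> t (int k)" for k
  define h where "h k = tau \<rho> t (int k + 1) / tau \<rho> t (int k)" for k
  interpret partial_skew_orthogonal "moment \<rho> t" "single_moment \<rho> t" P h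
  proof
    fix k i j
    show "h k \<noteq> 0"
      using tau[of k] tau[of "Suc k"] by (simp add: h_def add.commute)
    show "moment \<rho> t i j = - moment \<rho> t j i" by (rule skew)
    show "moment \<rho> t (Suc i) j + moment \<rho> t i (Suc j) =
        single_moment \<rho> t (Suc i) * single_moment \<rho> t j - single_moment \<rho> t i * single_moment \<rho> t (Suc j)"
      by (rule moment_add[OF g int[OF t]])
    show "degree (P k) \<le> k"
      unfolding P_def by (rule degree_Ppoly_le[OF skew])
    show "coeff (P k) k = 1"
      unfolding P_def by (rule coeff_Ppoly_lead[OF skew tau])
    show "lin (\<lambda>i. moment \<rho> t i j) (P k) = (if even k then 0 else - h k) * single_moment \<rho> t j" if "j \<le> k"
      using lin_moment_Ppoly[OF skew tau that] by (simp add: P_def h_def)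
    show "lin (single_moment \<rho> t) (P k) = (if even k then h k else 0)"
      using lin_single_moment_Ppoly[OF skew tau] by (simp add: P_def h_def)
  qed
  have b_Suc: "bcoef \<rho> t (int (Suc k)) = - coeff (P (Suc k)) k" for k
    unfolding bcoef_def deriv_tau[OF skew deriv_moment deriv_single] P_def coeff_Ppoly[OF skew] by simp
  have tau_0: "tau \<rho> s 0 = 1" for s
    by (simp add: tau_def)
  have b_0: "bcoef \<rho> t 0 = 0"
    by (simp add: bcoef_def tau_0)
  have u_0: "ucoef \<rho> t 0 = 0"
    by (simp add: ucoef_def tau_def)
  have u_Suc: "ucoef \<rho> t (int (Suc k)) = u k" for k
    using tau[of k] tau[of "Suc k"] by (simp add: ucoef_def u_def h_def power2_eq_square add.commute)
  have P_neg: "Ppoly \<rho> t k = 0" if "k < 0" for k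
    using that by (simp add: Ppoly_def)
  consider "n = 0" | "n = 1" | m where "n = int (Suc (Suc m))"
    using n by (metis nonneg_int_cases not0_implies_Suc of_nat_0 of_nat_1 One_nat_def)
  then show ?thesis
  proof cases
    case 1
    \<comment> \<open>For \<open>n = 0\<close> the terms with \<open>u_0\<close> drop out, and
      \<open>P_0 = 1\<close> with \<open>P_1\<close> monic of degree 1 leaves only its constant
      coefficient \<open>- b_1\<close>.\<close>
    have "coeff ([:0, 1:] * P 0) i = coeff (P (Suc 0) + smult (- coeff (P (Suc 0)) 0) (P 0)) i" for i
    proof -
      consider "i = 0" | "i = Suc 0" | "i > Suc 0" by linarith
      then show ?thesis
        using coeff_P[of 0] coeff_P[of "Suc 0"] degree_P[of 0] degree_P[of "Suc 0"]
        by cases (auto simp: coeff_eq_0 coeff_pCons split: nat.split)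
    qed
    then have "[:0, 1:] * P 0 = P (Suc 0) + smult (- coeff (P (Suc 0)) 0) (P 0)"
      by (rule poly_eqI)
    then show ?thesis
      using b_Suc[of 0] by (simp add: 1 b_0 u_0 P_def)
  next
    case 2
    then show ?thesis
      using recurrence(2) b_Suc[of 0] b_Suc[of 1] u_Suc[of 0] u_Suc[of 1]
      by (simp add: P_neg P_def numeral_2_eq_2)
  next
    case (3 m)
    have "n + 1 = int (Suc (Suc (Suc m)))" "n - 1 = int (Suc m)" "n - 2 = int m"
      using 3 by auto
    then show ?thesis
      using recurrence(1)[of m] 3
      by (simp only: b_Suc u_Suc P_def[symmetric]) (simp add: algebra_simps)
  qed
qed

end
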